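(* Let $K=K(n)$ be positive integers with $K\to\infty$ and $n/K\to\infty$ as $n\to\infty$, and assume that the initial law $\mu_K$ of the walk $Y_K$ is the uniform distribution on $V_K$. Then the finite-dimensional laws of $\left(X_{n,K}(t)/\sqrt{K}\right)_{t\ge 0}$ converge to those of a Gaussian white noise $(G_t)_{t\ge 0}$, i.e. an i.i.d. collection of $\mathcal{N}(0,1)$ random variables: for every $s\ge1$ and all $0\le t_1<\dots<t_s$, \[\frac{1}{\sqrt K}\left(X_{n,K}(t_1),\dots,X_{n,K}(t_s)\right)\overset{\mathcal{D}}{\underset{n\to\infty}{\longrightarrow}}(G_{t_1},\dots,G_{t_s}).\]
   Context: For $K\ge 1$, $V_K=\{-1,+1\}^K$ is the vertex set of the $K$-dimensional hypercube, in which two vertices are adjacent iff they differ in exactly one coordinate. $(Y_K(i))_{i\ge 0}$ is the simple random walk on this graph (at each step a uniformly chosen coordinate, independent of the past, changes sign), started from the law $\mu_K$ on $V_K$. $f_K(v)=\sum_{i=1}^K v^{(i)}$ for $v\in V_K$, and $X_{n,K}(t)=f_K(Y_K(\lfloor nt\rfloor))$ for $t\ge 0$. *)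

theory Defs
  imports "HOL-Probability.Probability"
begin

definition hypercube :: "nat \<Rightarrow> (nat \<Rightarrow> real) set" where
  "hypercube K = {1..K} \<rightarrow>\<^sub>E {-1, 1}"

definition hypercube_adj :: "nat \<Rightarrow> (nat \<Rightarrow> real) \<Rightarrow> (nat \<Rightarrow> real) \<Rightarrow> bool" where
  "hypercube_adj K v w \<longleftrightarrow>
     v \<in> hypercube K \<and> w \<in> hypercube K \<and> card {i \<in> {1..K}. v i \<noteq> w i} = 1"

definition hypercube_step :: "nat \<Rightarrow> (nat \<Rightarrow> real) \<Rightarrow> (nat \<Rightarrow> real) pmf" where
  "hypercube_step K v = pmf_of_set {w. hypercube_adj K v w}"

lemma hypercube_neighbours:
  assumes "v \<in> hypercube K"
  shows "{w. hypercube_adj K v w} = (\<lambda>i. v(i := - v i)) ` {1..K}"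
proof (intro equalityI subsetI)
  fix w assume "w \<in> {w. hypercube_adj K v w}"
  then have w: "w \<in> hypercube K" and c: "card {i \<in> {1..K}. v i \<noteq> w i} = 1"
    by (auto simp: hypercube_adj_def)
  then obtain i where i: "{i \<in> {1..K}. v i \<noteq> w i} = {i}"
    by (auto simp: card_1_singleton_iff)
  then have iK: "i \<in> {1..K}" "v i \<noteq> w i" by auto
  have "w j = (v(i := - v i)) j" for j
  proof (cases "j \<in> {1..K}")
    case True
    then have "v j \<in> {-1, 1}" "w j \<in> {-1, 1}"
      using assms w by (auto simp: hypercube_def PiE_def Pi_def)
    moreover have "j \<noteq> i \<Longrightarrow> v j = w j" using i True by auto
    ultimately show ?thesis using iK by auto
  next
    case False
    then have "v j = undefined" "w j = undefined" "j \<noteq> i"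
      using assms w iK by (auto simp: hypercube_def PiE_def extensional_def)
    then show ?thesis by simp
  qed
  then show "w \<in> (\<lambda>i. v(i := - v i)) ` {1..K}" using iK by blast
next
  fix w assume "w \<in> (\<lambda>i. v(i := - v i)) ` {1..K}"
  then obtain i where i: "i \<in> {1..K}" and w: "w = v(i := - v i)" by auto
  have vi: "v i \<in> {-1, 1}" using assms i by (auto simp: hypercube_def PiE_def Pi_def)
  then have "{j \<in> {1..K}. v j \<noteq> w j} = {i}" using i w by auto
  moreover have "w \<in> hypercube K"
    using assms i vi unfolding w hypercube_def
    by (auto simp: PiE_def Pi_def extensional_def)
  ultimately show "w \<in> {w. hypercube_adj K v w}"
    using assms by (simp add: hypercube_adj_def)
qed

text \<open>A step of the walk changes the sign of a uniformly chosen coordinate.\<close>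

lemma hypercube_step_flip:
  assumes "v \<in> hypercube K" and "K \<ge> 1"
  shows "hypercube_step K v = map_pmf (\<lambda>i. v(i := - v i)) (pmf_of_set {1..K})"
proof -
  have "inj_on (\<lambda>i. v(i := - v i)) {1..K}"
  proof (rule inj_onI)
    fix i j assume i: "i \<in> {1..K}" and eq: "v(i := - v i) = v(j := - v j)"
    have "v i \<in> {-1, 1}" using assms i by (auto simp: hypercube_def PiE_def Pi_def)
    then show "i = j" using fun_cong[OF eq, of i] by (auto split: if_splits)
  qed
  then show ?thesis
    using assms unfolding hypercube_step_def hypercube_neighbours[OF assms(1)]
    by (subst map_pmf_of_set_inj) auto
qed

text \<open>
  Markov chain on the hypercube with initial law \<open>\<mu>\<close> and transition kernel
  \<open>hypercube_step K\<close>; the last clause is the Markov property, multiplied out so that no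
  conditioning on null events occurs.
\<close>

definition hypercube_walk ::
    "nat \<Rightarrow> (nat \<Rightarrow> real) pmf \<Rightarrow> 'a measure \<Rightarrow> (nat \<Rightarrow> 'a \<Rightarrow> nat \<Rightarrow> real) \<Rightarrow> bool" where
  "hypercube_walk K \<mu> M Y \<longleftrightarrow>
     prob_space M \<and>
     (\<forall>i. Y i \<in> measurable M (count_space (hypercube K))) \<and>
     (\<forall>v \<in> hypercube K. measure M {\<omega> \<in> space M. Y 0 \<omega> = v} = pmf \<mu> v) \<and>
     (\<forall>i v. (\<forall>j \<le> Suc i. v j \<in> hypercube K) \<longrightarrow>
        measure M {\<omega> \<in> space M. \<forall>j \<le> Suc i. Y j \<omega> = v j} =
        measure M {\<omega> \<in> space M. \<forall>j \<le> i. Y j \<omega> = v j} * pmf (hypercube_step K (v i)) (v (Suc i)))"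

definition coord_sum :: "nat \<Rightarrow> (nat \<Rightarrow> real) \<Rightarrow> real" where
  "coord_sum K v = (\<Sum>i = 1..K. v i)"

definition walk_sum ::
    "(nat \<Rightarrow> nat \<Rightarrow> 'a \<Rightarrow> nat \<Rightarrow> real) \<Rightarrow> nat \<Rightarrow> nat \<Rightarrow> real \<Rightarrow> 'a \<Rightarrow> real" where
  "walk_sum Y n K t \<omega> = coord_sum K (Y K (nat \<lfloor>real n * t\<rfloor>) \<omega>)"

definition gaussian_white_noise :: "'b measure \<Rightarrow> (real \<Rightarrow> 'b \<Rightarrow> real) \<Rightarrow> bool" where
  "gaussian_white_noise N G \<longleftrightarrow>
     prob_space N \<and>
     prob_space.indep_vars N (\<lambda>_. borel) G {0..} \<and>
     (\<forall>t \<ge> 0. distributed N lborel (G t) std_normal_density)"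

lemma gaussian_white_noise_exists:
  "\<exists>(N :: (real \<Rightarrow> real) measure) G. gaussian_white_noise N G"
proof -
  let ?g = "density lborel std_normal_density"
  let ?N = "PiM {0..} (\<lambda>_::real. ?g)"
  have g: "prob_space ?g" by (rule prob_space_normal_density) simp
  interpret product_prob_space "\<lambda>_::real. ?g" "{0..}"
    using g by (simp add: product_prob_space_def product_prob_space_axioms_def
        product_sigma_finite_def prob_space_imp_sigma_finite)
  have P: "prob_space ?N" by (rule prob_space_PiM) (rule g)
  have d: "distr ?N ?g (\<lambda>\<omega>. \<omega> t) = ?g" if "t \<in> {0..}" for t :: real
    by (rule PiM_component[OF that])
  have m: "(\<lambda>\<omega>. \<omega> t) \<in> measurable ?N borel" if "t \<in> {0..}" for t :: real
    using measurable_component_singleton[OF that, of "\<lambda>_. ?g"]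
    by (simp cong: measurable_cong_sets)
  have d': "distr ?N lborel (\<lambda>\<omega>. \<omega> t) = ?g" if "t \<in> {0..}" for t :: real
    using d[OF that] by (simp cong: distr_cong)
  have "prob_space.indep_vars ?N (\<lambda>_. borel) (\<lambda>t \<omega>. \<omega> t) {0..}"
  proof (subst prob_space.indep_vars_iff_distr_eq_PiM'[OF P])
    show "{0::real..} \<noteq> {}" by auto
    show "(\<lambda>\<omega>. \<omega> t) \<in> measurable ?N borel" if "t \<in> {0..}" for t :: real
      by (rule m[OF that])
    have r: "restrict \<omega> {0..} = \<omega>" if "\<omega> \<in> space ?N" for \<omega>
      using that by (auto simp: space_PiM PiE_def extensional_restrict)
    have "distr ?N (PiM {0..} (\<lambda>_. borel)) (\<lambda>\<omega>. \<lambda>t\<in>{0..}. \<omega> t) = distr ?N ?N (\<lambda>\<omega>. \<omega>)"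
      by (rule distr_cong) (auto simp: r intro!: sets_PiM_cong)
    also have "\<dots> = ?N" by (rule distr_id2) simp
    also have "\<dots> = PiM {0..} (\<lambda>t. distr ?N borel (\<lambda>\<omega>. \<omega> t))"
    proof (rule PiM_cong)
      fix t :: real assume "t \<in> {0..}"
      have "distr ?N borel (\<lambda>\<omega>. \<omega> t) = distr ?N lborel (\<lambda>\<omega>. \<omega> t)"
        by (rule distr_cong) auto
      then show "?g = distr ?N borel (\<lambda>\<omega>. \<omega> t)" using d'[OF \<open>t \<in> {0..}\<close>] by simp
    qed simp
    finally show "distr ?N (PiM {0..} (\<lambda>_. borel)) (\<lambda>\<omega>. \<lambda>t\<in>{0..}. \<omega> t) =
      PiM {0..} (\<lambda>t. distr ?N borel (\<lambda>\<omega>. \<omega> t))" .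
  qed
  moreover have "distributed ?N lborel (\<lambda>\<omega>. \<omega> t) std_normal_density" if "t \<ge> 0" for t
    using d'[of t] m[of t] that by (auto simp: distributed_def)
  ultimately show ?thesis
    unfolding gaussian_white_noise_def using P by blast
qed

definition weak_conv_in :: "'a topology \<Rightarrow> (nat \<Rightarrow> 'a measure) \<Rightarrow> 'a measure \<Rightarrow> bool" where
  "weak_conv_in T L L' \<longleftrightarrow>
     (\<forall>f. continuous_map T euclideanreal f \<and> bounded (f ` topspace T) \<longrightarrow>
        (\<lambda>n. \<integral>x. f x \<partial>L n) \<longlonglongrightarrow> (\<integral>x. f x \<partial>L'))"

text \<open>
  \<open>\<real>\<^sup>s\<close> is represented by the extensional functions on \<open>{1..s}\<close>, with the product topology
  and the product \<open>\<sigma>\<close>-algebra (which is its Borel \<open>\<sigma>\<close>-algebra).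
\<close>

definition vec_law ::
    "nat \<Rightarrow> 'a measure \<Rightarrow> (nat \<Rightarrow> 'a \<Rightarrow> real) \<Rightarrow> (nat \<Rightarrow> real) measure" where
  "vec_law s M Z = distr M (PiM {1..s} (\<lambda>_. borel)) (\<lambda>\<omega>. \<lambda>i\<in>{1..s}. Z i \<omega>)"

end

theory Submission imports Defs "HOL-Real_Asymp.Real_Asymp" begin

text \<open>
  The Walsh functions \<open>\<Prod>i\<in>S. v i\<close> diagonalise the transition operator, with eigenvalues
  \<open>1 - 2|S|/K\<close>. By Parseval, \<open>m\<close> steps with \<open>m/K \<rightarrow> \<infinity>\<close> bring every function on the cube close in
  \<open>L\<^sup>2\<close> of the uniform law to its mean, except for its component along the parity function, whose
  eigenvalue is \<open>-1\<close>; for a Lipschitz function of \<open>f\<^sub>K/\<surd>K\<close> that component is \<open>O(1/\<surd>K)\<close>.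
  Hence the values at distinct times decorrelate, each being uniformly distributed with
  characteristic function \<open>cos (\<theta>/\<surd>K)^K \<rightarrow> exp (-\<theta>\<^sup>2/2)\<close>, so that expectations of products
  of bounded Lipschitz functions of the coordinates converge to the Gaussian ones. Clamping the
  coordinates to a large box and applying Stone--Weierstrass there passes to arbitrary bounded
  continuous functions.
\<close>

section \<open>Weak convergence tested on products\<close>

text \<open>The cube is bipartite: given the start, the parity of the position at any time is
  deterministic, so the walk does not mix in total variation however many steps are taken. The test
  functions must therefore be nearly blind to parity. Lipschitz functions of the rescaled sum are,
  since one flip moves it by only 2/sqrt(K). A bound in mean square over the cube is enough because
  the uniform law is invariant: the position at the earlier time is again uniform, so the error made
  by averaging over the future is itself averaged uniformly. The eigenvalues other than 1 and -1
  have modulus at most 1 - 2/K, and about n(t' - t) steps separate two observation times t < t',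
  which is many multiples of K. Boundedness makes the test class closed under products. Tightness is
  not assumed anywhere; it is inherited from the limit law, because tails can be measured by members
  of the test class.\<close>

definition bounded_lipschitz :: "(real \<Rightarrow> real) \<Rightarrow> bool" where
  "bounded_lipschitz g \<longleftrightarrow> (\<exists>L. \<forall>x y. \<bar>g x - g y\<bar> \<le> L * \<bar>x - y\<bar>) \<and> (\<exists>B. \<forall>x. \<bar>g x\<bar> \<le> B)"

text \<open>For R >= 0, the nearest-point projection onto [-R, R]. It is 1-Lipschitz, so composition
  with it preserves the test class.\<close>

definition clamp_real :: "real \<Rightarrow> real \<Rightarrow> real" where
  "clamp_real R x = max (- R) (min R x)"

lemma bounded_lipschitz_const: "bounded_lipschitz (\<lambda>_. c)"
  unfolding bounded_lipschitz_def by (auto intro: exI[of _ 0])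

lemma bounded_lipschitz_continuous:
  assumes "bounded_lipschitz g"
  shows "continuous_on A g"
proof -
  obtain L where L: "\<bar>g x - g y\<bar> \<le> L * \<bar>x - y\<bar>" for x y
    using assms by (auto simp: bounded_lipschitz_def)
  have "L \<ge> 0" using L[of 1 0] by simp
  then have "L-lipschitz_on A g"
    using L by (intro lipschitz_onI) (auto simp: dist_real_def)
  then show ?thesis by (rule lipschitz_on_continuous_on)
qed

lemma bounded_lipschitz_mult:
  assumes "bounded_lipschitz f" "bounded_lipschitz g"
  shows "bounded_lipschitz (\<lambda>x. f x * g x)"
proof -
  obtain L B where f: "\<bar>f x - f y\<bar> \<le> L * \<bar>x - y\<bar>" "\<bar>f x\<bar> \<le> B" for x y
    using assms(1) unfolding bounded_lipschitz_def by metis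
  obtain L' B' where g: "\<bar>g x - g y\<bar> \<le> L' * \<bar>x - y\<bar>" "\<bar>g x\<bar> \<le> B'" for x y
    using assms(2) unfolding bounded_lipschitz_def by metis
  have B: "B \<ge> 0" "B' \<ge> 0" using f(2)[of 0] g(2)[of 0] by linarith+
  have "\<bar>f x * g x - f y * g y\<bar> \<le> (B * L' + B' * L) * \<bar>x - y\<bar>" for x y
  proof -
    have "\<bar>f x * g x - f y * g y\<bar> = \<bar>f x * (g x - g y) + g y * (f x - f y)\<bar>"
      by (simp add: algebra_simps)
    also have "\<dots> \<le> \<bar>f x\<bar> * \<bar>g x - g y\<bar> + \<bar>g y\<bar> * \<bar>f x - f y\<bar>"
      by (metis abs_mult abs_triangle_ineq)
    also have "\<dots> \<le> B * (L' * \<bar>x - y\<bar>) + B' * (L * \<bar>x - y\<bar>)"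
      using f g B by (intro add_mono mult_mono) auto
    finally show ?thesis by (simp add: algebra_simps)
  qed
  moreover have "\<bar>f x * g x\<bar> \<le> B * B'" for x
    unfolding abs_mult using f g B by (intro mult_mono) auto
  ultimately show ?thesis unfolding bounded_lipschitz_def by blast
qed

lemma bounded_lipschitz_comp_clamp:
  assumes "bounded_lipschitz g"
  shows "bounded_lipschitz (\<lambda>x. g (clamp_real R x))"
proof -
  obtain L B where g: "\<bar>g x - g y\<bar> \<le> L * \<bar>x - y\<bar>" "\<bar>g x\<bar> \<le> B" for x y
    using assms(1) unfolding bounded_lipschitz_def by metis
  have L: "L \<ge> 0" using g(1)[of 1 0] by simp
  have "\<bar>g (clamp_real R x) - g (clamp_real R y)\<bar> \<le> L * \<bar>x - y\<bar>" for x y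
  proof (rule order_trans[OF g(1) mult_left_mono[OF _ L]])
    show "\<bar>clamp_real R x - clamp_real R y\<bar> \<le> \<bar>x - y\<bar>"
      unfolding clamp_real_def by linarith
  qed
  then show ?thesis using g(2) unfolding bounded_lipschitz_def by blast
qed

lemma bounded_lipschitz_clamp: "bounded_lipschitz (clamp_real R)"
proof -
  have "\<bar>clamp_real R x - clamp_real R y\<bar> \<le> 1 * \<bar>x - y\<bar>" "\<bar>clamp_real R x\<bar> \<le> \<bar>R\<bar>" for x y
    unfolding clamp_real_def by (simp_all add: max_def min_def abs_if)
  then show ?thesis unfolding bounded_lipschitz_def by blast
qed

text \<open>Linear combinations of products of one-coordinate functions form an algebra that separates
  points, and clamping maps it into itself; so an approximation on a box extends to all of space.\<close>

inductive product_sum :: "'i set \<Rightarrow> (('i \<Rightarrow> real) \<Rightarrow> real) \<Rightarrow> bool" for I where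
  prod: "(\<And>i. bounded_lipschitz (g i)) \<Longrightarrow> product_sum I (\<lambda>x. c * (\<Prod>i\<in>I. g i (x i)))"
| add: "product_sum I p \<Longrightarrow> product_sum I q \<Longrightarrow> product_sum I (\<lambda>x. p x + q x)"

lemma product_sum_const: "product_sum I (\<lambda>_. c)"
  using product_sum.prod[of "\<lambda>_ _. 1" I c] by (simp add: bounded_lipschitz_const)

text \<open>All other coordinates receive the constant factor 1. This puts into the algebra the
  clamped coordinates, which separate points of a box, and the functions that measure tails.\<close>

lemma product_sum_coord:
  assumes "finite I" "i \<in> I" "bounded_lipschitz g"
  shows "product_sum I (\<lambda>x. c * g (x i))"
proof -
  have "product_sum I (\<lambda>x. c * (\<Prod>j\<in>I. (if j = i then g else (\<lambda>_. 1)) (x j)))"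
    using assms by (intro product_sum.prod) (auto simp: bounded_lipschitz_const)
  also have "(\<lambda>x. c * (\<Prod>j\<in>I. (if j = i then g else (\<lambda>_. 1)) (x j))) = (\<lambda>x. c * g (x i))"
    using assms by (auto simp: if_distribR prod.delta cong: if_cong)
  finally show ?thesis .
qed

lemma product_sum_sum:
  assumes "finite J" "\<And>j. j \<in> J \<Longrightarrow> product_sum I (p j)"
  shows "product_sum I (\<lambda>x. \<Sum>j\<in>J. p j x)"
  using assms by (induction J rule: finite_induct) (auto intro: product_sum_const product_sum.add)

lemma product_sum_mult:
  assumes "product_sum I p" "product_sum I q"
  shows "product_sum I (\<lambda>x. p x * q x)"
  using assms
proof (induction arbitrary: q rule: product_sum.induct)
  case (prod g c)
  note g = prod.hyps
  from prod.prems show ?case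
  proof (induction rule: product_sum.induct)
    case (prod g' c')
    have "product_sum I (\<lambda>x. c * c' * (\<Prod>i\<in>I. g i (x i) * g' i (x i)))"
      by (rule product_sum.prod) (intro bounded_lipschitz_mult g prod)
    then show ?case by (simp add: prod.distrib mult_ac)
  next
    case (add p q)
    then show ?case by (simp add: distrib_left product_sum.add)
  qed
next
  case (add p p')
  then show ?case by (simp add: distrib_right product_sum.add)
qed

lemma product_sum_clamp:
  assumes "product_sum I p"
  shows "product_sum I (\<lambda>x. p (\<lambda>i\<in>I. clamp_real R (x i)))"
  using assms
proof (induction rule: product_sum.induct)
  case (prod g c)
  have "product_sum I (\<lambda>x. c * (\<Prod>i\<in>I. g i (clamp_real R (x i))))"
    by (rule product_sum.prod) (intro bounded_lipschitz_comp_clamp prod)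
  then show ?case by (simp cong: prod.cong)
next
  case (add p q)
  then show ?case by (intro product_sum.add)
qed

lemma product_sum_continuous:
  fixes I :: "'i :: countable set"
  assumes "product_sum I p"
  shows "continuous_on A p"
  using assms
proof (induction rule: product_sum.induct)
  case (prod g c)
  have "continuous_on A (\<lambda>x. g i (x i))" for i
    by (rule continuous_on_compose2[OF bounded_lipschitz_continuous[OF prod, of UNIV]])
       (auto intro: continuous_on_subset[OF continuous_on_product_coordinates])
  then show ?case by (intro continuous_intros) auto
qed (intro continuous_intros)

lemma product_sum_approx:
  fixes I :: "'i :: countable set"
  assumes fin: "finite I" and R: "R \<ge> 0"
    and F: "continuous_on (I \<rightarrow>\<^sub>E {-R..R}) F" and e: "e > 0"
  obtains p where "product_sum I p" "\<And>x. \<bar>F (\<lambda>i\<in>I. clamp_real R (x i)) - p x\<bar> < e"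
proof -
  let ?S = "I \<rightarrow>\<^sub>E {-R..R}"
  have "function_ring_on {p. product_sum I p} ?S"
  proof
    \<comment> \<open>The topology is that of the full function type, so the box is written as a
      product over all indices, with the singleton \<open>{undefined}\<close> outside
      \<open>I\<close>; Tychonoff then gives compactness.\<close>
    have S: "?S = (\<Pi>\<^sub>E i\<in>UNIV. if i \<in> I then {-R..R} else {undefined})"
      by (auto simp: PiE_def Pi_def extensional_def split: if_splits)
    have "compactin (product_topology (\<lambda>_. euclidean) UNIV) (\<Pi>\<^sub>E i\<in>UNIV. if i \<in> I then {-R..R} else {undefined})"
      by (subst compactin_PiE) auto
    then show "compact ?S" unfolding S euclidean_product_topology compactin_euclidean_iff .
    show "continuous_on ?S f" if "f \<in> {p. product_sum I p}" for f
      using that by (auto intro: product_sum_continuous)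
    show "\<exists>f\<in>{p. product_sum I p}. f x \<noteq> f y" if xy: "x \<in> ?S" "y \<in> ?S" "x \<noteq> y" for x y
    proof -
      obtain i where i: "i \<in> I" "x i \<noteq> y i" using PiE_ext[OF xy(1,2)] xy(3) by blast
      have "product_sum I (\<lambda>x. 1 * clamp_real R (x i))"
        by (rule product_sum_coord[OF fin i(1) bounded_lipschitz_clamp])
      moreover have "clamp_real R (x i) = x i" "clamp_real R (y i) = y i"
        using xy i by (auto simp: clamp_real_def PiE_def Pi_def)
      ultimately show ?thesis using i by (intro bexI[of _ "\<lambda>x. 1 * clamp_real R (x i)"]) auto
    qed
  qed (auto intro: product_sum.add product_sum_mult product_sum_const)
  from function_ring_on.Stone_Weierstrass_basic[OF this F e]
  obtain p where p: "product_sum I p" "\<And>x. x \<in> ?S \<Longrightarrow> \<bar>F x - p x\<bar> < e" by blast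
  \<comment> \<open>Clamped points always lie in the box because R >= 0. Hence the estimate on the
    box, composed with clamping, holds at every point of the whole space.\<close>
  have "(\<lambda>i\<in>I. clamp_real R (x i)) \<in> ?S" for x
    using R by (auto simp: clamp_real_def)
  then show ?thesis
    by (intro that[OF product_sum_clamp[OF p(1), of R]] p(2))
qed

lemma product_sum_bounded:
  assumes "product_sum I p" "finite I"
  shows "\<exists>B. \<forall>x. \<bar>p x\<bar> \<le> B"
  using assms(1)
proof (induction rule: product_sum.induct)
  case (prod g c)
  then obtain B where B: "\<bar>g i x\<bar> \<le> B i" for i x unfolding bounded_lipschitz_def by metis
  have "\<bar>c * (\<Prod>i\<in>I. g i (x i))\<bar> \<le> \<bar>c\<bar> * (\<Prod>i\<in>I. B i)" for x
    unfolding abs_mult abs_prod using B by (intro mult_left_mono prod_mono) auto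
  then show ?case by blast
next
  case (add p q)
  then obtain B B' where "\<bar>p x\<bar> \<le> B" "\<bar>q x\<bar> \<le> B'" for x by blast
  then have "\<bar>p x + q x\<bar> \<le> B + B'" for x by (meson abs_triangle_ineq add_mono order_trans)
  then show ?case by blast
qed

lemma product_sum_measurable:
  assumes "product_sum I p" "sets L = sets (PiM I (\<lambda>_. borel))"
  shows "p \<in> borel_measurable L"
  using assms(1)
proof (induction rule: product_sum.induct)
  case (prod g c)
  have "g i \<in> borel_measurable borel" for i
    by (rule borel_measurable_continuous_onI[OF bounded_lipschitz_continuous[OF prod]])
  note [measurable] = this
  have "(\<lambda>x. c * (\<Prod>i\<in>I. g i (x i))) \<in> borel_measurable (PiM I (\<lambda>_. borel))" by measurable
  then show ?case by (simp add: measurable_cong_sets[OF assms(2) refl])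
qed measurable

lemma product_sum_integrable:
  assumes "product_sum I p" "finite I" "prob_space L" "sets L = sets (PiM I (\<lambda>_. borel))"
  shows "integrable L p"
proof -
  interpret prob_space L by fact
  obtain B where "\<And>x. \<bar>p x\<bar> \<le> B" using product_sum_bounded[OF assms(1,2)] by blast
  then show ?thesis
    using product_sum_measurable[OF assms(1,4)] by (intro integrable_const_bound[where B = B]) auto
qed

text \<open>A Lipschitz substitute for the indicator of |x| > R: zero for |x| <= R and one for |x|
  >= R + 1. Unlike the indicator it belongs to the test class.\<close>

definition tail_cutoff :: "real \<Rightarrow> real \<Rightarrow> real" where
  "tail_cutoff R x = min 1 (max 0 (\<bar>x\<bar> - R))"

lemma bounded_lipschitz_tail_cutoff: "bounded_lipschitz (tail_cutoff R)"
proof -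
  have "\<bar>tail_cutoff R x - tail_cutoff R y\<bar> \<le> 1 * \<bar>x - y\<bar>" "\<bar>tail_cutoff R x\<bar> \<le> 1" for x y
    unfolding tail_cutoff_def by (simp_all add: max_def min_def abs_if)
  then show ?thesis unfolding bounded_lipschitz_def by blast
qed

lemma tail_cutoff_integral_tendsto_0:
  assumes "prob_space L" "sets L = sets (PiM I (\<lambda>_. borel))" "i \<in> I" "finite I"
  shows "(\<lambda>n. \<integral>x. tail_cutoff (real n) (x i) \<partial>L) \<longlonglongrightarrow> 0"
proof -
  interpret prob_space L by fact
  have "(\<lambda>n. \<integral>x. tail_cutoff (real n) (x i) \<partial>L) \<longlonglongrightarrow> (\<integral>x. 0 \<partial>L)"
  proof (rule integral_dominated_convergence[where w = "\<lambda>_. 1"])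
    show "(\<lambda>x. tail_cutoff (real n) (x i)) \<in> borel_measurable L" for n
      using product_sum_measurable[OF product_sum_coord[OF assms(4,3) bounded_lipschitz_tail_cutoff, of 1 "real n"] assms(2)]
      by simp
    show "AE x in L. (\<lambda>n. tail_cutoff (real n) (x i)) \<longlonglongrightarrow> 0"
    proof (intro AE_I2 tendsto_eventually)
      fix x :: "'a \<Rightarrow> real"
      have "eventually (\<lambda>n. real n \<ge> \<bar>x i\<bar>) sequentially"
        using filterlim_real_sequentially by (simp add: filterlim_at_top)
      then show "eventually (\<lambda>n. tail_cutoff (real n) (x i) = 0) sequentially"
        by eventually_elim (simp add: tail_cutoff_def)
    qed
    show "AE x in L. norm (tail_cutoff (real n) (x i)) \<le> 1" for n
      by (auto simp: tail_cutoff_def)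
  qed auto
  then show ?thesis by simp
qed

text \<open>Tightness comes out of the hypothesis \<open>conv\<close>: cutoffs of single coordinates
  are admissible test functions, so the tails of \<open>L n\<close> are eventually close to those of
  \<open>L'\<close>, and the latter are small by dominated convergence.\<close>

lemma weak_conv_in_product_topologyI:
  fixes I :: "'i :: countable set"
  assumes fin: "finite I"
    and prob: "\<And>n. prob_space (L n)" "prob_space L'"
    and sets: "\<And>n. sets (L n) = sets (PiM I (\<lambda>_. borel))" "sets L' = sets (PiM I (\<lambda>_. borel))"
    and conv: "\<And>g. (\<And>i. bounded_lipschitz (g i)) \<Longrightarrow>
      (\<lambda>n. \<integral>x. (\<Prod>i\<in>I. g i (x i)) \<partial>L n) \<longlonglongrightarrow> (\<integral>x. (\<Prod>i\<in>I. g i (x i)) \<partial>L')"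
  shows "weak_conv_in (product_topology (\<lambda>_. euclideanreal) I) L L'"
  unfolding weak_conv_in_def
proof (intro allI impI, elim conjE)
  fix f :: "('i \<Rightarrow> real) \<Rightarrow> real"
  let ?T = "product_topology (\<lambda>_. euclideanreal) I"
  assume f: "continuous_map ?T euclideanreal f" and bdd: "bounded (f ` topspace ?T)"
  note integrable = product_sum_integrable[OF _ fin]
  have convp: "(\<lambda>n. \<integral>x. p x \<partial>L n) \<longlonglongrightarrow> (\<integral>x. p x \<partial>L')" if "product_sum I p" for p
    using that
  proof (induction rule: product_sum.induct)
    case (prod g c)
    then show ?case using conv[of g] by (simp add: tendsto_mult_left)
  next
    case (add p q)
    then show ?case
      using integrable[OF _ prob(1) sets(1)] integrable[OF _ prob(2) sets(2)]
      by (simp add: tendsto_add)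
  qed
  \<comment> \<open>\<open>f\<close> is only controlled on extensional functions, whereas the
    approximation takes place in the full function type. \<open>F\<close> is continuous there and
    agrees with \<open>f\<close> where the laws live.\<close>
  define F where "F x = f (restrict x I)" for x
  have cont: "continuous_on A F" for A
  proof -
    have "continuous_map euclidean ?T (\<lambda>x. restrict x I)"
      by (subst continuous_map_componentwise) (auto intro: continuous_on_product_coordinates)
    from continuous_map_compose[OF this f] have "continuous_on UNIV F"
      by (simp add: F_def o_def)
    then show ?thesis by (rule continuous_on_subset) simp
  qed
  have ext: "F x = f x" if "x \<in> extensional I" for x
    using that by (simp add: F_def extensional_restrict)
  obtain B where B: "\<And>x. \<bar>F x\<bar> \<le> B"
  proof -
    obtain B where "\<And>x. x \<in> topspace ?T \<Longrightarrow> \<bar>f x\<bar> \<le> B" using bdd by (auto simp: bounded_iff)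
    then show ?thesis by (intro that[of B]) (auto simp: F_def)
  qed
  then have B0: "B \<ge> 0" by (meson abs_ge_zero order_trans)
  have measF: "F \<in> borel_measurable Q" if "sets Q = sets (PiM I (\<lambda>_. borel))" for Q
  proof -
    have "(\<lambda>x :: 'i \<Rightarrow> real. restrict x I) \<in> borel_measurable (PiM I (\<lambda>_. borel))"
    proof (rule measurable_coordinatewise_then_product)
      fix i
      show "(\<lambda>x :: 'i \<Rightarrow> real. restrict x I i) \<in> borel_measurable (PiM I (\<lambda>_. borel))"
        by (cases "i \<in> I") auto
    qed
    from measurable_compose[OF this borel_measurable_continuous_onI[OF cont]]
    have "(\<lambda>x. F x) \<in> borel_measurable (PiM I (\<lambda>_. borel))" by (simp add: F_def)
    then show ?thesis by (simp add: measurable_cong_sets[OF that refl])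
  qed
  have intF: "integrable Q F" if "prob_space Q" "sets Q = sets (PiM I (\<lambda>_. borel))" for Q
  proof -
    interpret prob_space Q by fact
    show ?thesis using B by (intro integrable_const_bound[where B = B] measF that) auto
  qed
  have fF: "(\<integral>x. f x \<partial>Q) = (\<integral>x. F x \<partial>Q)" if "sets Q = sets (PiM I (\<lambda>_. borel))" for Q
    using sets_eq_imp_space_eq[OF that]
    by (intro Bochner_Integration.integral_cong) (auto simp: space_PiM ext PiE_def)
  have "(\<lambda>n. \<integral>x. F x \<partial>L n) \<longlonglongrightarrow> (\<integral>x. F x \<partial>L')"
  proof (rule LIMSEQ_I)
    fix r :: real assume "r > 0"
    \<comment> \<open>Error budget: 3e for replacing F by p under \<open>L n\<close> (whose tail
      term is below 2e), e for the convergence of the integrals of p, and 2e for the replacement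
      under \<open>L'\<close>.\<close>
    define e where "e = r / 6"
    have e: "e > 0" using \<open>r > 0\<close> by (simp add: e_def)
    \<comment> \<open>Clamping can change the value of F by at most 2B, and only if some coordinate
      is large; summing the cutoffs over the coordinates covers every such case.\<close>
    define q where "q R x = (\<Sum>i\<in>I. (2 * B) * tail_cutoff R (x i))" for R and x :: "'i \<Rightarrow> real"
    have q: "product_sum I (q R)" for R
      unfolding q_def by (intro product_sum_sum fin product_sum_coord bounded_lipschitz_tail_cutoff)
    have "(\<lambda>n. \<Sum>i\<in>I. 2 * B * (\<integral>x. tail_cutoff (real n) (x i) \<partial>L')) \<longlonglongrightarrow> (\<Sum>i\<in>I. 2 * B * 0)"
      by (intro tendsto_intros tail_cutoff_integral_tendsto_0[OF prob(2) sets(2) _ fin])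
    moreover have "(\<integral>x. q (real n) x \<partial>L') = (\<Sum>i\<in>I. 2 * B * (\<integral>x. tail_cutoff (real n) (x i) \<partial>L'))" for n
    proof -
      have "integrable L' (\<lambda>x. 2 * B * tail_cutoff (real n) (x i))" if "i \<in> I" for i
        by (intro integrable[OF _ prob(2) sets(2)] product_sum_coord fin that bounded_lipschitz_tail_cutoff)
      then show ?thesis unfolding q_def by (simp add: Bochner_Integration.integral_sum)
    qed
    ultimately have "(\<lambda>n. \<integral>x. q (real n) x \<partial>L') \<longlonglongrightarrow> 0" by simp
    then have "eventually (\<lambda>n. (\<integral>x. q (real n) x \<partial>L') < e) sequentially"
      using e by (rule order_tendstoD)
    then obtain R :: nat where R: "(\<integral>x. q (real R) x \<partial>L') < e"
      by (auto simp: eventually_sequentially)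
    \<comment> \<open>The cutoff at R reaches the value 1 at R + 1, so wherever clamping to
      \<open>R'\<close> moves a coordinate, one summand of \<open>q R\<close> already equals
      2B.\<close>
    define R' where "R' = real R + 1"
    obtain p where p: "product_sum I p" "\<And>x. \<bar>F (\<lambda>i\<in>I. clamp_real R' (x i)) - p x\<bar> < e"
      by (rule product_sum_approx[OF fin _ cont e, of R']) (auto simp: R'_def)
    have Fp: "\<bar>F x - p x\<bar> \<le> e + q R x" for x
    proof -
      have "\<bar>F x - F (\<lambda>i\<in>I. clamp_real R' (x i))\<bar> \<le> q R x"
      proof (cases "\<forall>i\<in>I. \<bar>x i\<bar> \<le> R'")
        case True
        then have "(\<lambda>i\<in>I. clamp_real R' (x i)) = restrict x I"
          by (intro restrict_ext) (auto simp: clamp_real_def abs_le_iff)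
        then have "F (\<lambda>i\<in>I. clamp_real R' (x i)) = F x" by (simp add: F_def)
        moreover have "q R x \<ge> 0"
          unfolding q_def using B0 by (intro sum_nonneg mult_nonneg_nonneg) (auto simp: tail_cutoff_def)
        ultimately show ?thesis by simp
      next
        case False
        then obtain i where i: "i \<in> I" "\<bar>x i\<bar> > R'" by auto
        have "\<bar>F x - F (\<lambda>i\<in>I. clamp_real R' (x i))\<bar> \<le> 2 * B"
          using B[of x] B[of "\<lambda>i\<in>I. clamp_real R' (x i)"] by linarith
        also have "\<dots> = 2 * B * tail_cutoff R (x i)"
          using i by (simp add: tail_cutoff_def R'_def)
        also have "\<dots> \<le> q R x"
          unfolding q_def using B0 i fin by (intro member_le_sum) (auto simp: tail_cutoff_def)
        finally show ?thesis .
      qed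
      then show ?thesis using p(2)[of x] by linarith
    qed
    have close: "\<bar>(\<integral>x. F x \<partial>Q) - (\<integral>x. p x \<partial>Q)\<bar> \<le> e + (\<integral>x. q R x \<partial>Q)"
      if Q: "prob_space Q" "sets Q = sets (PiM I (\<lambda>_. borel))" for Q
    proof -
      interpret prob_space Q by fact
      note int = intF[OF Q] integrable[OF p(1) Q] integrable[OF q[of R] Q]
      have "\<bar>(\<integral>x. F x \<partial>Q) - (\<integral>x. p x \<partial>Q)\<bar> = \<bar>\<integral>x. F x - p x \<partial>Q\<bar>" using int by simp
      also have "\<dots> \<le> (\<integral>x. \<bar>F x - p x\<bar> \<partial>Q)" by (rule integral_abs_bound)
      also have "\<dots> \<le> (\<integral>x. e + q R x \<partial>Q)"
        using int Fp by (intro integral_mono) auto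
      also have "\<dots> = e + (\<integral>x. q R x \<partial>Q)" using int by (simp add: prob_space)
      finally show ?thesis .
    qed
    obtain n1 where n1: "\<And>n. n \<ge> n1 \<Longrightarrow> norm ((\<integral>x. p x \<partial>L n) - (\<integral>x. p x \<partial>L')) < e"
      using LIMSEQ_D[OF convp[OF p(1)] e] by blast
    obtain n2 where n2: "\<And>n. n \<ge> n2 \<Longrightarrow> norm ((\<integral>x. q R x \<partial>L n) - (\<integral>x. q R x \<partial>L')) < e"
      using LIMSEQ_D[OF convp[OF q] e] by blast
    show "\<exists>no. \<forall>n\<ge>no. norm ((\<integral>x. F x \<partial>L n) - (\<integral>x. F x \<partial>L')) < r"
    proof (intro exI allI impI)
      fix n assume "n \<ge> max n1 n2"
      then have "\<bar>(\<integral>x. p x \<partial>L n) - (\<integral>x. p x \<partial>L')\<bar> < e" "\<bar>(\<integral>x. q R x \<partial>L n) - (\<integral>x. q R x \<partial>L')\<bar> < e"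
        using n1[of n] n2[of n] by simp_all
      moreover note R close[OF prob(1) sets(1), of n] close[OF prob(2) sets(2)]
      ultimately have "\<bar>(\<integral>x. F x \<partial>L n) - (\<integral>x. F x \<partial>L')\<bar> < 6 * e"
        unfolding abs_less_iff abs_le_iff by linarith
      then show "norm ((\<integral>x. F x \<partial>L n) - (\<integral>x. F x \<partial>L')) < r" by (simp add: e_def)
    qed
  qed
  then show "(\<lambda>n. \<integral>x. f x \<partial>L n) \<longlonglongrightarrow> (\<integral>x. f x \<partial>L')"
    using fF[OF sets(1)] fF[OF sets(2)] by simp
qed

section \<open>Walsh functions on the hypercube\<close>

definition cube_mean :: "nat \<Rightarrow> ((nat \<Rightarrow> real) \<Rightarrow> real) \<Rightarrow> real" where
  "cube_mean K h = (\<Sum>v\<in>hypercube K. h v) / 2 ^ K"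

text \<open>The transition operator of the walk, written without \<open>pmf\<close> so that the
  spectral analysis is a matter of finite sums; \<open>sum_pmf_hypercube_step\<close> identifies it
  with the kernel on the cube.\<close>

definition flip_average :: "nat \<Rightarrow> ((nat \<Rightarrow> real) \<Rightarrow> real) \<Rightarrow> (nat \<Rightarrow> real) \<Rightarrow> real" where
  "flip_average K h v = (\<Sum>i = 1..K. h (v(i := - v i))) / real K"

definition walsh :: "nat set \<Rightarrow> (nat \<Rightarrow> real) \<Rightarrow> real" where
  "walsh S v = (\<Prod>i\<in>S. v i)"

section \<open>Uniform averages and coordinate flips on the cube\<close>

lemma finite_hypercube: "finite (hypercube K)"
  unfolding hypercube_def by (intro finite_PiE) auto

lemma card_hypercube: "card (hypercube K) = 2 ^ K"
  unfolding hypercube_def by (subst card_PiE) (auto simp: numeral_2_eq_2)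

lemma hypercube_coord: "v \<in> hypercube K \<Longrightarrow> i \<in> {1..K} \<Longrightarrow> v i = 1 \<or> v i = -1"
  by (auto simp: hypercube_def PiE_def Pi_def)

lemma hypercube_flip: "v \<in> hypercube K \<Longrightarrow> i \<in> {1..K} \<Longrightarrow> v(i := - v i) \<in> hypercube K"
  using hypercube_neighbours[of v K] by (auto simp: hypercube_adj_def)

text \<open>Each flip is an involution of the cube. This yields invariance of the uniform law under
  the walk, and also the pairing of vertices that makes the parity component small.\<close>

lemma sum_hypercube_flip:
  assumes "i \<in> {1..K}"
  shows "(\<Sum>v\<in>hypercube K. h (v(i := - v i))) = (\<Sum>v\<in>hypercube K. h v)"
  by (rule sum.reindex_bij_witness[of _ "\<lambda>v. v(i := - v i)" "\<lambda>v. v(i := - v i)"])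
    (use assms in \<open>auto simp: hypercube_flip\<close>)

text \<open>Distributivity, that is, independence of the coordinates under the uniform law. The
  general codomain serves real values for orthogonality and complex values for characteristic
  functions.\<close>

lemma sum_hypercube_prod:
  fixes a :: "nat \<Rightarrow> real \<Rightarrow> 'b :: comm_semiring_1"
  shows "(\<Sum>v\<in>hypercube K. \<Prod>i\<in>{1..K}. a i (v i)) = (\<Prod>i\<in>{1..K}. a i (-1) + a i 1)"
  unfolding hypercube_def by (subst prod_sum_PiE[symmetric]) auto

lemma cube_mean_const: "cube_mean K (\<lambda>_. c) = c"
  by (simp add: cube_mean_def card_hypercube)

lemma cube_mean_mono: "(\<And>v. v \<in> hypercube K \<Longrightarrow> f v \<le> g v) \<Longrightarrow> cube_mean K f \<le> cube_mean K g"
  unfolding cube_mean_def by (intro divide_right_mono sum_mono) auto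

lemma cube_mean_cong: "(\<And>v. v \<in> hypercube K \<Longrightarrow> f v = g v) \<Longrightarrow> cube_mean K f = cube_mean K g"
  unfolding cube_mean_def by simp

lemma cube_mean_sum: "cube_mean K (\<lambda>v. \<Sum>i\<in>I. f i v) = (\<Sum>i\<in>I. cube_mean K (f i))"
  unfolding cube_mean_def by (subst sum.swap) (simp add: sum_divide_distrib)

lemma cube_mean_add: "cube_mean K (\<lambda>v. f v + g v) = cube_mean K f + cube_mean K g"
  unfolding cube_mean_def by (simp add: sum.distrib add_divide_distrib)

lemma cube_mean_cmult: "cube_mean K (\<lambda>v. c * f v) = c * cube_mean K f"
  unfolding cube_mean_def by (simp add: sum_distrib_left)

lemma cube_mean_flip_average:
  assumes "K \<ge> 1"
  shows "cube_mean K (flip_average K h) = cube_mean K h"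
proof -
  have "(\<Sum>v\<in>hypercube K. \<Sum>i = 1..K. h (v(i := - v i))) = (\<Sum>i = 1..K. \<Sum>v\<in>hypercube K. h v)"
    by (subst sum.swap, rule sum.cong[OF refl], rule sum_hypercube_flip)
  then show ?thesis
    using assms by (simp add: cube_mean_def flip_average_def sum_divide_distrib[symmetric])
qed

lemma flip_average_cong:
  assumes "\<And>v. v \<in> hypercube K \<Longrightarrow> f v = g v" "v \<in> hypercube K"
  shows "flip_average K f v = flip_average K g v"
  unfolding flip_average_def
  by (intro arg_cong2[where f = "(/)"] sum.cong refl assms hypercube_flip)

section \<open>Spectral decomposition of the transition operator\<close>

lemma walsh_flip:
  assumes "S \<subseteq> {1..K}"
  shows "walsh S (v(i := - v i)) = (if i \<in> S then - walsh S v else walsh S v)"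
proof (cases "i \<in> S")
  case True
  have fin: "finite S" using assms finite_subset by blast
  have "(\<Prod>j\<in>S - {i}. (v(i := - v i)) j) = (\<Prod>j\<in>S - {i}. v j)"
    by (intro prod.cong) auto
  then show ?thesis
    using True unfolding walsh_def by (simp add: prod.remove[OF fin True])
next
  case False
  then show ?thesis unfolding walsh_def by (auto intro!: prod.cong)
qed

text \<open>Among the K flips, those with index in S negate the function and the others fix it,
  which leaves (K - 2 card S)/K.\<close>

lemma flip_average_walsh:
  assumes "S \<subseteq> {1..K}" "K \<ge> 1"
  shows "flip_average K (walsh S) v = (1 - 2 * real (card S) / real K) * walsh S v"
proof -
  have fin: "finite S" using assms finite_subset by blast
  have "(\<Sum>i = 1..K. walsh S (v(i := - v i))) = (\<Sum>i = 1..K. walsh S v - 2 * (if i \<in> S then walsh S v else 0))"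
    by (intro sum.cong refl) (auto simp: walsh_flip[OF assms(1)])
  also have "\<dots> = real K * walsh S v - 2 * (\<Sum>i\<in>{1..K} \<inter> S. walsh S v)"
    by (simp only: sum_subtractf sum_distrib_left[symmetric] sum.inter_restrict[symmetric] finite_atLeastAtMost)
       simp
  also have "{1..K} \<inter> S = S" using assms by auto
  finally show ?thesis using assms by (simp add: flip_average_def field_simps del: fun_upd_apply)
qed

lemma flip_average_walsh_sum:
  assumes "K \<ge> 1"
  shows "flip_average K (\<lambda>v. \<Sum>S\<in>Pow {1..K}. a S * walsh S v) v =
    (\<Sum>S\<in>Pow {1..K}. (a S * (1 - 2 * real (card S) / real K)) * walsh S v)"
proof -
  have "flip_average K (\<lambda>v. \<Sum>S\<in>Pow {1..K}. a S * walsh S v) v =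
     (\<Sum>S\<in>Pow {1..K}. a S * flip_average K (walsh S) v)"
    unfolding flip_average_def
    by (subst sum.swap) (simp add: sum_divide_distrib sum_distrib_left)
  also have "\<dots> = (\<Sum>S\<in>Pow {1..K}. (a S * (1 - 2 * real (card S) / real K)) * walsh S v)"
    by (intro sum.cong refl) (simp add: flip_average_walsh[OF _ assms])
  finally show ?thesis .
qed

lemma walsh_eq_prod:
  assumes "S \<subseteq> {1..K}"
  shows "walsh S v = (\<Prod>i\<in>{1..K}. if i \<in> S then v i else 1)"
proof -
  have "{1..K} \<inter> S = S" using assms by auto
  then show ?thesis unfolding walsh_def by (simp add: prod.inter_restrict[symmetric])
qed

text \<open>The sum over the cube factorises over coordinates. A coordinate lying in exactly one of
  S and T contributes -1 + 1 = 0, any other contributes 2.\<close>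

lemma walsh_orthonormal:
  assumes "S \<subseteq> {1..K}" "T \<subseteq> {1..K}"
  shows "cube_mean K (\<lambda>v. walsh S v * walsh T v) = (if S = T then 1 else 0)"
proof -
  define a :: "nat \<Rightarrow> real \<Rightarrow> real"
    where "a i x = (if i \<in> S then x else 1) * (if i \<in> T then x else 1)" for i x
  have "(\<Sum>v\<in>hypercube K. walsh S v * walsh T v) = (\<Sum>v\<in>hypercube K. \<Prod>i\<in>{1..K}. a i (v i))"
    unfolding a_def prod.distrib walsh_eq_prod[OF assms(1)] walsh_eq_prod[OF assms(2)] ..
  also have "\<dots> = (\<Prod>i\<in>{1..K}. a i (-1) + a i 1)" by (rule sum_hypercube_prod)
  also have "\<dots> = (if S = T then 2 ^ K else 0)"
  proof (cases "S = T")
    case True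
    then have "(\<Prod>i\<in>{1..K}. a i (-1) + a i 1) = (\<Prod>i\<in>{1..K}. 2)"
      by (intro prod.cong) (auto simp: a_def)
    then show ?thesis using True by simp
  next
    case False
    then obtain i where "i \<in> {1..K}" "i \<in> S \<longleftrightarrow> i \<notin> T" using assms by blast
    then have "\<exists>i\<in>{1..K}. a i (-1) + a i 1 = 0" by (intro bexI[of _ i]) (auto simp: a_def)
    then show ?thesis using False by simp
  qed
  finally show ?thesis by (simp add: cube_mean_def)
qed

lemma walsh_parseval:
  "cube_mean K (\<lambda>v. (\<Sum>S\<in>Pow {1..K}. a S * walsh S v)\<^sup>2) = (\<Sum>S\<in>Pow {1..K}. (a S)\<^sup>2)"
proof -
  have "cube_mean K (\<lambda>v. (\<Sum>S\<in>Pow {1..K}. a S * walsh S v)\<^sup>2) =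
     cube_mean K (\<lambda>v. \<Sum>S\<in>Pow {1..K}. \<Sum>T\<in>Pow {1..K}. (a S * a T) * (walsh S v * walsh T v))"
    by (intro cube_mean_cong) (simp add: power2_eq_square sum_product mult_ac)
  also have "\<dots> = (\<Sum>S\<in>Pow {1..K}. \<Sum>T\<in>Pow {1..K}. (a S * a T) * (if S = T then 1 else 0))"
    unfolding cube_mean_sum cube_mean_cmult
    by (intro sum.cong refl) (simp add: walsh_orthonormal)
  also have "\<dots> = (\<Sum>S\<in>Pow {1..K}. (a S)\<^sup>2)"
    by (intro sum.cong refl) (simp add: power2_eq_square if_distrib sum.delta cong: if_cong)
  finally show ?thesis .
qed

text \<open>The dual orthogonality relation: expanding the product of the factors
  \<open>w i * v i + 1\<close> gives the sum over all S, and a coordinate at which the two vertices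
  differ makes its factor vanish.\<close>

lemma walsh_complete:
  assumes v: "v \<in> hypercube K" and w: "w \<in> hypercube K"
  shows "(\<Sum>S\<in>Pow {1..K}. walsh S w * walsh S v) = (if w = v then 2 ^ K else 0)"
proof -
  have "(\<Sum>S\<in>Pow {1..K}. walsh S w * walsh S v) = (\<Prod>i\<in>{1..K}. w i * v i + 1)"
    by (subst prod_add) (simp_all add: walsh_def prod.distrib)
  also have "\<dots> = (if w = v then 2 ^ K else 0)"
  proof (cases "w = v")
    case True
    then have "(\<Prod>i\<in>{1..K}. w i * v i + 1) = (\<Prod>i\<in>{1..K}. 2)"
      by (intro prod.cong refl) (use hypercube_coord[OF v] in force)
    then show ?thesis using True by simp
  next
    case False
    have "\<exists>i\<in>{1..K}. w i \<noteq> v i"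
      using False PiE_ext[OF w[unfolded hypercube_def] v[unfolded hypercube_def]] by blast
    then obtain i where i: "i \<in> {1..K}" "w i \<noteq> v i" by blast
    then have "w i * v i + 1 = 0" using hypercube_coord[OF v i(1)] hypercube_coord[OF w i(1)] by auto
    then show ?thesis using False i by auto
  qed
  finally show ?thesis .
qed

lemma walsh_expansion:
  assumes v: "v \<in> hypercube K"
  shows "h v = (\<Sum>S\<in>Pow {1..K}. cube_mean K (\<lambda>w. h w * walsh S w) * walsh S v)"
proof -
  have "(\<Sum>S\<in>Pow {1..K}. cube_mean K (\<lambda>w. h w * walsh S w) * walsh S v)
     = (\<Sum>w\<in>hypercube K. h w * (\<Sum>S\<in>Pow {1..K}. walsh S w * walsh S v)) / 2 ^ K"
    unfolding cube_mean_def sum_divide_distrib sum_distrib_left sum_distrib_right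
    by (subst sum.swap) (simp add: mult_ac)
  also have "\<dots> = (\<Sum>w\<in>hypercube K. if w = v then h v * 2 ^ K else 0) / 2 ^ K"
    by (intro arg_cong2[where f = "(/)"] sum.cong refl) (simp add: walsh_complete[OF v] del: One_nat_def)
  also have "\<dots> = h v" using v finite_hypercube by (simp add: sum.delta)
  finally show ?thesis by simp
qed

lemma flip_average_power_expansion:
  assumes K: "K \<ge> 1" and v: "v \<in> hypercube K"
  shows "(flip_average K ^^ m) h v =
    (\<Sum>S\<in>Pow {1..K}. (cube_mean K (\<lambda>w. h w * walsh S w) * (1 - 2 * real (card S) / real K) ^ m) * walsh S v)"
  using v
proof (induction m arbitrary: v)
  case 0
  then show ?case using walsh_expansion[of v K h] by simp
next
  case (Suc m)
  have "(flip_average K ^^ Suc m) h v = flip_average K ((flip_average K ^^ m) h) v" by simp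
  \<comment> \<open>The expansion of the inner iterate is known on the cube only; that suffices,
    since flips of a vertex remain in the cube.\<close>
  also have "\<dots> = flip_average K (\<lambda>v. \<Sum>S\<in>Pow {1..K}. (cube_mean K (\<lambda>w. h w * walsh S w)
      * (1 - 2 * real (card S) / real K) ^ m) * walsh S v) v"
    by (rule flip_average_cong) (use Suc in auto)
  also have "\<dots> = (\<Sum>S\<in>Pow {1..K}. (cube_mean K (\<lambda>w. h w * walsh S w)
      * (1 - 2 * real (card S) / real K) ^ Suc m) * walsh S v)"
    by (subst flip_average_walsh_sum[OF K]) (simp add: mult_ac)
  finally show ?case .
qed

text \<open>The eigenvalue \<open>-1\<close> of the parity function \<open>walsh {1..K}\<close> does not decay;
  it contributes the second term.\<close>

lemma flip_average_variance_decay: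
  assumes K: "K \<ge> 1"
  shows "cube_mean K (\<lambda>v. ((flip_average K ^^ m) h v - cube_mean K h)\<^sup>2) \<le>
    (1 - 2 / real K) ^ (2 * m) * cube_mean K (\<lambda>v. (h v)\<^sup>2) + (cube_mean K (\<lambda>v. h v * walsh {1..K} v))\<^sup>2"
proof -
  define c where "c S = cube_mean K (\<lambda>w. h w * walsh S w)" for S
  define l where "l S = 1 - 2 * real (card S) / real K" for S :: "nat set"
  \<comment> \<open>The empty set carries the eigenvalue 1 and the coefficient
    \<open>cube_mean K h\<close>, so dropping it is the same as subtracting the mean.\<close>
  define b where "b S = (if S = {} then 0 else c S * l S ^ m)" for S
  have c0: "c {} = cube_mean K h" "l {} = 1" by (simp_all add: c_def l_def walsh_def)
  have "(flip_average K ^^ m) h v - cube_mean K h = (\<Sum>S\<in>Pow {1..K}. b S * walsh S v)"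
    if "v \<in> hypercube K" for v
  proof -
    have "(flip_average K ^^ m) h v = (\<Sum>S\<in>Pow {1..K}. (c S * l S ^ m) * walsh S v)"
      using flip_average_power_expansion[OF K that, of m h] by (simp add: c_def l_def)
    also have "\<dots> = (\<Sum>S\<in>Pow {1..K}. b S * walsh S v + (if S = {} then cube_mean K h else 0))"
      by (intro sum.cong refl) (auto simp: b_def c0 walsh_def)
    also have "\<dots> = (\<Sum>S\<in>Pow {1..K}. b S * walsh S v) + cube_mean K h"
      by (subst sum.distrib) (simp add: sum.delta)
    finally show ?thesis by simp
  qed
  then have "cube_mean K (\<lambda>v. ((flip_average K ^^ m) h v - cube_mean K h)\<^sup>2) = (\<Sum>S\<in>Pow {1..K}. (b S)\<^sup>2)"
    by (subst walsh_parseval[symmetric]) (auto intro!: cube_mean_cong)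
  also have "\<dots> \<le> (\<Sum>S\<in>Pow {1..K}. (1 - 2 / real K) ^ (2 * m) * (c S)\<^sup>2 + (if S = {1..K} then (c S)\<^sup>2 else 0))"
  proof (rule sum_mono)
    fix S assume S: "S \<in> Pow {1..K}"
    then have fin: "finite S" using finite_subset by blast
    consider "S = {}" | "S = {1..K}" "S \<noteq> {}" | "S \<noteq> {1..K}" "S \<noteq> {}" by blast
    then show "(b S)\<^sup>2 \<le> (1 - 2 / real K) ^ (2 * m) * (c S)\<^sup>2 + (if S = {1..K} then (c S)\<^sup>2 else 0)"
    proof cases
      case 1
      then show ?thesis by (simp add: b_def power_mult)
    next
      case 2
      then have "l S = -1" using K by (simp add: l_def)
      then have "(b S)\<^sup>2 = (c S)\<^sup>2" using 2
        by (simp add: b_def power_mult_distrib power_mult[symmetric])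
      then show ?thesis using 2 by (simp add: power_mult)
    next
      case 3
      have "card S < K" using 3 S psubset_card_mono[of "{1..K}" S] by auto
      moreover have "card S \<ge> 1" using 3 fin by (simp add: Suc_le_eq card_gt_0_iff)
      \<comment> \<open>Here 1 <= card S <= K - 1, and the two extremes give the eigenvalues 1 - 2/K
        and -(1 - 2/K), the largest in modulus in this case.\<close>
      ultimately have "real (card S) \<ge> 1" "real (card S) \<le> real K - 1" by linarith+
      then have "1 / real K \<le> real (card S) / real K" "real (card S) / real K \<le> 1 - 1 / real K"
        using K by (simp_all add: field_simps)
      then have "\<bar>l S\<bar> \<le> \<bar>1 - 2 / real K\<bar>" by (simp add: l_def)
      then have "(l S)\<^sup>2 \<le> (1 - 2 / real K)\<^sup>2" by (simp add: abs_le_square_iff)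
      then have "((l S)\<^sup>2) ^ m \<le> ((1 - 2 / real K)\<^sup>2) ^ m" by (rule power_mono) simp
      then have "(c S)\<^sup>2 * ((l S)\<^sup>2) ^ m \<le> (c S)\<^sup>2 * ((1 - 2 / real K)\<^sup>2) ^ m"
        by (intro mult_left_mono) auto
      then show ?thesis using 3
        by (simp add: b_def power_mult_distrib power_mult[symmetric] mult_ac)
    qed
  qed
  also have "\<dots> = (1 - 2 / real K) ^ (2 * m) * (\<Sum>S\<in>Pow {1..K}. (c S)\<^sup>2) + (c {1..K})\<^sup>2"
    by (subst sum.distrib) (simp add: sum_distrib_left sum.delta)
  also have "(\<Sum>S\<in>Pow {1..K}. (c S)\<^sup>2) = cube_mean K (\<lambda>v. (h v)\<^sup>2)"
    by (subst walsh_parseval[symmetric])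
       (intro cube_mean_cong, simp only: c_def walsh_expansion[symmetric])
  finally show ?thesis by (simp add: c_def)
qed

text \<open>The variance of |h| under the uniform law is nonnegative.\<close>

lemma cube_mean_abs_le_sqrt:
  "cube_mean K (\<lambda>v. \<bar>h v\<bar>) \<le> sqrt (cube_mean K (\<lambda>v. (h v)\<^sup>2))"
proof (rule real_le_rsqrt)
  define m where "m = cube_mean K (\<lambda>v. \<bar>h v\<bar>)"
  have "0 \<le> cube_mean K (\<lambda>v. (\<bar>h v\<bar> - m)\<^sup>2)"
    unfolding cube_mean_def by (intro divide_nonneg_nonneg sum_nonneg) auto
  also have "\<dots> = cube_mean K (\<lambda>v. (h v)\<^sup>2 + (- 2 * m) * \<bar>h v\<bar> + m\<^sup>2)"
    by (simp add: power2_diff algebra_simps)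
  also have "\<dots> = cube_mean K (\<lambda>v. (h v)\<^sup>2) - 2 * m * m + m\<^sup>2"
    by (simp only: cube_mean_add cube_mean_cmult cube_mean_const m_def[symmetric])
  finally show "(cube_mean K (\<lambda>v. \<bar>h v\<bar>))\<^sup>2 \<le> cube_mean K (\<lambda>v. (h v)\<^sup>2)"
    by (simp add: m_def power2_eq_square)
qed

lemma coord_sum_flip:
  assumes "i \<in> {1..K}"
  shows "coord_sum K (v(i := - v i)) = coord_sum K v - 2 * v i"
proof -
  have "(\<Sum>j\<in>{1..K} - {i}. (v(i := - v i)) j) = (\<Sum>j\<in>{1..K} - {i}. v j)"
    by (intro sum.cong) auto
  then show ?thesis
    unfolding coord_sum_def by (simp only: sum.remove[OF finite_atLeastAtMost assms]) simp
qed

text \<open>Pair each vertex with its flip at coordinate 1. Parity changes sign, so the two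
  contributions combine to a difference of values of g at points 2/sqrt(K) apart. The pairing counts
  every vertex twice, which removes the factor 2.\<close>

lemma parity_coefficient_le:
  assumes K: "K \<ge> 1" and lip: "\<And>x y. \<bar>g x - g y\<bar> \<le> L * \<bar>x - y\<bar>"
  shows "\<bar>cube_mean K (\<lambda>v. g (coord_sum K v / sqrt K) * walsh {1..K} v)\<bar> \<le> L / sqrt K"
proof -
  define h where "h v = g (coord_sum K v / sqrt K)" for v
  define f where "f v = h v * walsh {1..K} v" for v
  have one: "1 \<in> {1..K}" using K by simp
  have "2 * (\<Sum>v\<in>hypercube K. f v) = (\<Sum>v\<in>hypercube K. f v + f (v(1 := - v 1)))"
    by (simp add: sum.distrib sum_hypercube_flip[OF one, of f] del: fun_upd_apply One_nat_def)
  also have "\<bar>\<dots>\<bar> \<le> (\<Sum>v\<in>hypercube K. 2 * (L / sqrt K))"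
  proof (rule order_trans[OF sum_abs], rule sum_mono)
    fix v assume v: "v \<in> hypercube K"
    have w: "\<bar>walsh {1..K} v\<bar> = 1"
      unfolding walsh_def abs_prod using hypercube_coord[OF v] by (intro prod.neutral) force
    have "f v + f (v(1 := - v 1)) = (h v - h (v(1 := - v 1))) * walsh {1..K} v"
      using one by (simp add: f_def walsh_flip[of _ K] left_diff_distrib del: fun_upd_apply One_nat_def)
    then have "\<bar>f v + f (v(1 := - v 1))\<bar> = \<bar>h v - h (v(1 := - v 1))\<bar>"
      using w by (simp add: abs_mult)
    also have "\<dots> \<le> L * \<bar>coord_sum K v / sqrt K - (coord_sum K v - 2 * v 1) / sqrt K\<bar>"
      unfolding h_def coord_sum_flip[OF one] by (rule lip)
    also have "\<dots> = 2 * (L / sqrt K)"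
      using hypercube_coord[OF v one] by (auto simp: diff_divide_distrib)
    finally show "\<bar>f v + f (v(1 := - v 1))\<bar> \<le> 2 * (L / sqrt K)" .
  qed
  finally have "2 * \<bar>\<Sum>v\<in>hypercube K. f v\<bar> \<le> 2 * (2 ^ K * (L / sqrt K))"
    by (simp add: card_hypercube abs_mult mult_ac)
  then have "\<bar>\<Sum>v\<in>hypercube K. f v\<bar> \<le> 2 ^ K * (L / sqrt K)" by linarith
  then show ?thesis
    by (simp add: cube_mean_def f_def h_def abs_divide field_simps)
qed

section \<open>Decorrelation along the walk\<close>

text \<open>Restricting the history to \<open>{..a}\<close> makes it an element of a finite set of
  extensional functions, so integrals of functions of the past become finite sums.\<close>

abbreviation walk_path :: "(nat \<Rightarrow> 'a \<Rightarrow> nat \<Rightarrow> real) \<Rightarrow> nat \<Rightarrow> 'a \<Rightarrow> nat \<Rightarrow> nat \<Rightarrow> real" where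
  "walk_path Y a \<omega> \<equiv> (\<lambda>j\<in>{..a}. Y j \<omega>)"

lemma hypercube_walkD:
  assumes "hypercube_walk K \<mu> M Y"
  shows hypercube_walk_prob_space: "prob_space M"
    and hypercube_walk_measurable: "Y i \<in> measurable M (count_space (hypercube K))"
    and hypercube_walk_initial: "v \<in> hypercube K \<Longrightarrow> measure M {\<omega>\<in>space M. Y 0 \<omega> = v} = pmf \<mu> v"
    and hypercube_walk_markov: "(\<And>j. j \<le> Suc i \<Longrightarrow> p j \<in> hypercube K) \<Longrightarrow>
      measure M {\<omega>\<in>space M. \<forall>j\<le>Suc i. Y j \<omega> = p j} =
      measure M {\<omega>\<in>space M. \<forall>j\<le>i. Y j \<omega> = p j} * pmf (hypercube_step K (p i)) (p (Suc i))"
proof -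
  note w = assms[unfolded hypercube_walk_def]
  show "prob_space M" by (rule conjunct1[OF w])
  show "Y i \<in> measurable M (count_space (hypercube K))"
    by (rule conjunct1[OF conjunct2[OF w], rule_format])
  show "measure M {\<omega>\<in>space M. Y 0 \<omega> = v} = pmf \<mu> v" if "v \<in> hypercube K"
    by (rule conjunct1[OF conjunct2[OF conjunct2[OF w]], rule_format, OF that])
  show "measure M {\<omega>\<in>space M. \<forall>j\<le>Suc i. Y j \<omega> = p j} =
      measure M {\<omega>\<in>space M. \<forall>j\<le>i. Y j \<omega> = p j} * pmf (hypercube_step K (p i)) (p (Suc i))"
    if "\<And>j. j \<le> Suc i \<Longrightarrow> p j \<in> hypercube K"
    by (rule conjunct2[OF conjunct2[OF conjunct2[OF w]], rule_format, OF that])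
qed

lemma sum_pmf_hypercube_step:
  assumes "v \<in> hypercube K" "K \<ge> 1"
  shows "(\<Sum>w\<in>hypercube K. h w * pmf (hypercube_step K v) w) = flip_average K h v"
proof -
  have "set_pmf (hypercube_step K v) \<subseteq> hypercube K"
    using assms by (auto simp: hypercube_step_flip hypercube_flip)
  then have "(\<Sum>w\<in>hypercube K. h w * pmf (hypercube_step K v) w) = (\<integral>w. h w \<partial>hypercube_step K v)"
    by (intro integral_measure_pmf_real[symmetric] finite_hypercube) auto
  also have "\<dots> = flip_average K h v"
    using assms by (simp add: hypercube_step_flip integral_pmf_of_set flip_average_def)
  finally show ?thesis .
qed

section \<open>Measurability and integration along the walk\<close>

lemma walk_path_sets:
  assumes "hypercube_walk K \<mu> M Y"
  shows "{\<omega>\<in>space M. \<forall>j\<le>a. Y j \<omega> = v j} \<in> sets M" "{\<omega>\<in>space M. Y a \<omega> = u} \<in> sets M"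
proof -
  have *: "{\<omega>\<in>space M. Y j \<omega> = u} \<in> sets M" for j u
  proof -
    note Y = hypercube_walk_measurable[OF assms, of j]
    \<comment> \<open>\<open>u\<close> need not be a vertex, and the target sigma-algebra contains
      only subsets of the cube. The intersection loses nothing because \<open>Y j\<close> takes its
      values there.\<close>
    have "Y j -` ({u} \<inter> hypercube K) \<inter> space M \<in> sets M"
      by (rule measurable_sets[OF Y]) simp
    also have "Y j -` ({u} \<inter> hypercube K) \<inter> space M = {\<omega>\<in>space M. Y j \<omega> = u \<and> Y j \<omega> \<in> hypercube K}"
      by auto
    also have "\<dots> = {\<omega>\<in>space M. Y j \<omega> = u}"
      using measurable_space[OF Y] unfolding space_count_space by blast
    finally show ?thesis .
  qed
  then show "{\<omega>\<in>space M. Y a \<omega> = u} \<in> sets M" .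
  have "{\<omega>\<in>space M. \<forall>j\<le>a. Y j \<omega> = v j} = (\<Inter>j\<in>{..a}. {\<omega>\<in>space M. Y j \<omega> = v j})"
    by auto
  also have "\<dots> \<in> sets M"
    by (rule sets.finite_INT) (use * in auto)
  finally show "{\<omega>\<in>space M. \<forall>j\<le>a. Y j \<omega> = v j} \<in> sets M" .
qed

lemma walk_mem_hypercube:
  assumes "hypercube_walk K \<mu> M Y" "\<omega> \<in> space M"
  shows "Y j \<omega> \<in> hypercube K"
  using measurable_space[OF hypercube_walk_measurable[OF assms(1)] assms(2)] by simp

text \<open>The path events partition the space, so exactly one indicator is 1. Every function of
  the history is thus a simple function, with no measurability condition on F.\<close>

lemma walk_path_simple:
  fixes F :: "(nat \<Rightarrow> nat \<Rightarrow> real) \<Rightarrow> real"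
  assumes walk: "hypercube_walk K \<mu> M Y" and \<omega>: "\<omega> \<in> space M"
  shows "F (walk_path Y a \<omega>) = (\<Sum>v\<in>{..a} \<rightarrow>\<^sub>E hypercube K.
      F v * indicator {\<omega>\<in>space M. \<forall>j\<le>a. Y j \<omega> = v j} \<omega>)"
proof -
  let ?p = "walk_path Y a \<omega>"
  have p: "?p \<in> {..a} \<rightarrow>\<^sub>E hypercube K"
    using walk_mem_hypercube[OF walk \<omega>] by auto
  have eq: "(\<forall>j\<le>a. Y j \<omega> = v j) \<longleftrightarrow> v = ?p" if "v \<in> {..a} \<rightarrow>\<^sub>E hypercube K" for v
    using that by (auto simp: fun_eq_iff PiE_def extensional_def)
  have "(\<Sum>v\<in>{..a} \<rightarrow>\<^sub>E hypercube K. F v * indicator {\<omega>\<in>space M. \<forall>j\<le>a. Y j \<omega> = v j} \<omega>)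
      = (\<Sum>v\<in>{..a} \<rightarrow>\<^sub>E hypercube K. if v = ?p then F v else 0)"
    by (intro sum.cong refl) (auto simp: indicator_def eq \<omega>)
  also have "\<dots> = F ?p"
    using p by (subst sum.delta) (auto intro!: finite_PiE finite_hypercube)
  finally show ?thesis by simp
qed

lemma walk_path_integrable:
  fixes F :: "(nat \<Rightarrow> nat \<Rightarrow> real) \<Rightarrow> real"
  assumes walk: "hypercube_walk K \<mu> M Y"
  shows "integrable M (\<lambda>\<omega>. F (walk_path Y a \<omega>))"
proof -
  interpret prob_space M by (rule hypercube_walk_prob_space[OF walk])
  define S where "S \<omega> = (\<Sum>v\<in>{..a} \<rightarrow>\<^sub>E hypercube K.
      F v * indicator {\<omega>\<in>space M. \<forall>j\<le>a. Y j \<omega> = v j} \<omega>)" for \<omega>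
  have "integrable M S"
    unfolding S_def
    by (intro Bochner_Integration.integrable_sum integrable_mult_right integrable_real_indicator
        walk_path_sets[OF walk]) (simp add: emeasure_eq_measure)
  moreover have "F (walk_path Y a \<omega>) = S \<omega>" if "\<omega> \<in> space M" for \<omega>
    unfolding S_def by (rule walk_path_simple[OF walk that])
  ultimately show ?thesis
    by (simp cong: Bochner_Integration.integrable_cong)
qed

lemma walk_integrable:
  fixes h :: "(nat \<Rightarrow> real) \<Rightarrow> real"
  assumes walk: "hypercube_walk K \<mu> M Y"
  shows "integrable M (\<lambda>\<omega>. h (Y a \<omega>))"
  using walk_path_integrable[OF walk, of "\<lambda>p. h (p a)" a] by simp

lemma walk_path_mult_integrable:
  fixes h :: "(nat \<Rightarrow> real) \<Rightarrow> real"
  assumes walk: "hypercube_walk K \<mu> M Y"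
  shows "integrable M (\<lambda>\<omega>. \<phi> (walk_path Y a \<omega>) * h (Y a \<omega>))"
  using walk_path_integrable[OF walk, of "\<lambda>p. \<phi> p * h (p a)" a] by simp

text \<open>The Markov property, given for individual paths, in integrated form: both integrals are
  finite sums over paths, and summing out the last position applies the transition operator to
  h.\<close>

lemma walk_one_step:
  fixes \<phi> :: "(nat \<Rightarrow> nat \<Rightarrow> real) \<Rightarrow> real"
  assumes walk: "hypercube_walk K \<mu> M Y" and K: "K \<ge> 1"
  shows "(\<integral>\<omega>. \<phi> (walk_path Y a \<omega>) * h (Y (Suc a) \<omega>) \<partial>M) =
         (\<integral>\<omega>. \<phi> (walk_path Y a \<omega>) * flip_average K h (Y a \<omega>) \<partial>M)"
proof -
  interpret prob_space M by (rule hypercube_walk_prob_space[OF walk])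
  let ?P = "{..a} \<rightarrow>\<^sub>E hypercube K" and ?V = "hypercube K"
  define A where "A v = {\<omega>\<in>space M. \<forall>j\<le>a. Y j \<omega> = v j}" for v
  define B where "B w = {\<omega>\<in>space M. Y (Suc a) \<omega> = w}" for w
  have sets: "A v \<in> sets M" "B w \<in> sets M" for v w
    unfolding A_def B_def by (rule walk_path_sets[OF walk])+
  have AB: "measure M (A v \<inter> B w) = measure M (A v) * pmf (hypercube_step K (v a)) w"
    if v: "v \<in> ?P" and w: "w \<in> ?V" for v w
  proof -
    let ?v = "v(Suc a := w)"
    have "?v j \<in> ?V" if "j \<le> Suc a" for j using that v w by (auto simp: le_Suc_eq)
    then have "measure M {\<omega>\<in>space M. \<forall>j\<le>Suc a. Y j \<omega> = ?v j} =
        measure M {\<omega>\<in>space M. \<forall>j\<le>a. Y j \<omega> = ?v j} * pmf (hypercube_step K (?v a)) (?v (Suc a))"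
      by (rule hypercube_walk_markov[OF walk])
    moreover have "{\<omega>\<in>space M. \<forall>j\<le>Suc a. Y j \<omega> = ?v j} = A v \<inter> B w"
      by (auto simp: A_def B_def le_Suc_eq)
    moreover have "{\<omega>\<in>space M. \<forall>j\<le>a. Y j \<omega> = ?v j} = A v" by (auto simp: A_def)
    ultimately show ?thesis by simp
  qed
  have "(\<integral>\<omega>. \<phi> (walk_path Y a \<omega>) * h (Y (Suc a) \<omega>) \<partial>M) =
    (\<integral>\<omega>. (\<Sum>v\<in>?P. \<Sum>w\<in>?V. \<phi> v * h w * indicator (A v \<inter> B w) \<omega>) \<partial>M)"
  proof (rule Bochner_Integration.integral_cong[OF refl])
    fix \<omega> assume \<omega>: "\<omega> \<in> space M"
    have "h (Y (Suc a) \<omega>) = (\<Sum>w\<in>?V. if w = Y (Suc a) \<omega> then h w else 0)"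
      by (subst sum.delta) (auto simp: finite_hypercube walk_mem_hypercube[OF walk \<omega>])
    also have "\<dots> = (\<Sum>w\<in>?V. h w * indicator (B w) \<omega>)"
      by (intro sum.cong refl) (auto simp: B_def \<omega>)
    finally have "\<phi> (walk_path Y a \<omega>) * h (Y (Suc a) \<omega>) =
        (\<Sum>v\<in>?P. \<phi> v * indicator (A v) \<omega>) * (\<Sum>w\<in>?V. h w * indicator (B w) \<omega>)"
      unfolding walk_path_simple[OF walk \<omega>, of \<phi> a] A_def by simp
    also have "\<dots> = (\<Sum>v\<in>?P. \<Sum>w\<in>?V. \<phi> v * h w * indicator (A v \<inter> B w) \<omega>)"
      unfolding sum_product by (simp add: indicator_inter_arith mult_ac)
    finally show "\<phi> (walk_path Y a \<omega>) * h (Y (Suc a) \<omega>) = \<dots>" .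
  qed
  also have "\<dots> = (\<Sum>v\<in>?P. \<Sum>w\<in>?V. \<phi> v * h w * measure M (A v \<inter> B w))"
    using sets by (simp add: Bochner_Integration.integral_sum emeasure_eq_measure)
  also have "\<dots> = (\<Sum>v\<in>?P. \<phi> v * measure M (A v) * (\<Sum>w\<in>?V. h w * pmf (hypercube_step K (v a)) w))"
    unfolding sum_distrib_left by (intro sum.cong refl) (simp add: AB mult_ac)
  also have "\<dots> = (\<Sum>v\<in>?P. \<phi> v * flip_average K h (v a) * measure M (A v))"
    by (intro sum.cong refl) (subst sum_pmf_hypercube_step, use K in auto)
  also have "\<dots> = (\<integral>\<omega>. (\<Sum>v\<in>?P. (\<phi> v * flip_average K h (v a)) * indicator (A v) \<omega>) \<partial>M)"
    using sets by (simp add: Bochner_Integration.integral_sum emeasure_eq_measure)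
  also have "\<dots> = (\<integral>\<omega>. \<phi> (walk_path Y a \<omega>) * flip_average K h (Y a \<omega>) \<partial>M)"
  proof (rule Bochner_Integration.integral_cong[OF refl])
    fix \<omega> assume "\<omega> \<in> space M"
    from walk_path_simple[OF walk this, of "\<lambda>p. \<phi> p * flip_average K h (p a)" a]
    show "(\<Sum>v\<in>?P. (\<phi> v * flip_average K h (v a)) * indicator (A v) \<omega>) =
      \<phi> (walk_path Y a \<omega>) * flip_average K h (Y a \<omega>)" by (simp add: A_def)
  qed
  finally show ?thesis .
qed

lemma walk_many_steps:
  fixes \<phi> :: "(nat \<Rightarrow> nat \<Rightarrow> real) \<Rightarrow> real"
  assumes walk: "hypercube_walk K \<mu> M Y" and K: "K \<ge> 1"
  shows "(\<integral>\<omega>. \<phi> (walk_path Y a \<omega>) * h (Y (a + m) \<omega>) \<partial>M) =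
         (\<integral>\<omega>. \<phi> (walk_path Y a \<omega>) * (flip_average K ^^ m) h (Y a \<omega>) \<partial>M)"
proof (induction m arbitrary: h)
  case 0
  show ?case by simp
next
  case (Suc m)
  \<comment> \<open>\<open>\<phi>\<close> is regarded as a function of the longer history that
    ignores all times after \<open>a\<close>, so the one-step identity applies at time
    \<open>a + m\<close>.\<close>
  have r: "restrict (walk_path Y (a + m) \<omega>) {..a} = walk_path Y a \<omega>" for \<omega>
    by (auto simp: restrict_def)
  have "(\<integral>\<omega>. \<phi> (walk_path Y a \<omega>) * h (Y (Suc (a + m)) \<omega>) \<partial>M) =
        (\<integral>\<omega>. \<phi> (walk_path Y a \<omega>) * flip_average K h (Y (a + m) \<omega>) \<partial>M)"
    using walk_one_step[OF walk K, of "\<lambda>p. \<phi> (restrict p {..a})" "a + m" h] by (simp only: r)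
  also have "\<dots> = (\<integral>\<omega>. \<phi> (walk_path Y a \<omega>) * (flip_average K ^^ m) (flip_average K h) (Y a \<omega>) \<partial>M)"
    by (rule Suc)
  finally show ?case by (simp only: funpow_Suc_right o_apply add_Suc_right)
qed

text \<open>With \<open>\<phi>\<close> = 1 and a = 0 the m-step identity moves the integral to time
  0, where the law is uniform; the transition operator preserves the uniform mean.\<close>

lemma walk_stationary:
  assumes walk: "hypercube_walk K (pmf_of_set (hypercube K)) M Y" and K: "K \<ge> 1"
  shows "(\<integral>\<omega>. h (Y m \<omega>) \<partial>M) = cube_mean K h"
proof -
  interpret prob_space M by (rule hypercube_walk_prob_space[OF walk])
  have 0: "(\<integral>\<omega>. h (Y 0 \<omega>) \<partial>M) = cube_mean K h" for h
  proof -
    have ne: "hypercube K \<noteq> {}" using card_hypercube[of K] by force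
    have "(\<integral>\<omega>. h (Y 0 \<omega>) \<partial>M) = (\<integral>\<omega>. (\<Sum>v\<in>hypercube K. h v * indicator {\<omega>\<in>space M. Y 0 \<omega> = v} \<omega>) \<partial>M)"
    proof (rule Bochner_Integration.integral_cong[OF refl])
      fix \<omega> assume \<omega>: "\<omega> \<in> space M"
      have "h (Y 0 \<omega>) = (\<Sum>w\<in>hypercube K. if w = Y 0 \<omega> then h w else 0)"
        by (subst sum.delta) (auto simp: finite_hypercube walk_mem_hypercube[OF walk \<omega>])
      also have "\<dots> = (\<Sum>v\<in>hypercube K. h v * indicator {\<omega>\<in>space M. Y 0 \<omega> = v} \<omega>)"
        by (intro sum.cong refl) (auto simp: \<omega>)
      finally show "h (Y 0 \<omega>) = \<dots>" .
    qed
    also have "\<dots> = (\<Sum>v\<in>hypercube K. h v * measure M {\<omega>\<in>space M. Y 0 \<omega> = v})"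
      using walk_path_sets(2)[OF walk] by (simp add: Bochner_Integration.integral_sum emeasure_eq_measure)
    also have "\<dots> = (\<Sum>v\<in>hypercube K. h v / 2 ^ K)"
      using ne by (intro sum.cong refl)
        (simp add: hypercube_walk_initial[OF walk] pmf_of_set finite_hypercube card_hypercube)
    finally show ?thesis by (simp add: cube_mean_def sum_divide_distrib)
  qed
  have "cube_mean K ((flip_average K ^^ m) h) = cube_mean K h"
    by (induction m) (simp_all add: cube_mean_flip_average[OF K])
  then show ?thesis
    using walk_many_steps[OF walk K, of "\<lambda>_. 1" 0 h m] by (simp add: 0)
qed

text \<open>Averaging over the m future steps replaces h by its m-th iterate at time a. Since the
  position at time a is uniform, the remaining error is B times an L1 norm over the cube, which the
  L2 norm dominates.\<close>

lemma walk_decorrelation: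
  fixes \<phi> :: "(nat \<Rightarrow> nat \<Rightarrow> real) \<Rightarrow> real"
  assumes walk: "hypercube_walk K (pmf_of_set (hypercube K)) M Y" and K: "K \<ge> 1"
    and bound: "\<And>p. \<bar>\<phi> p\<bar> \<le> B"
  shows "\<bar>(\<integral>\<omega>. \<phi> (walk_path Y a \<omega>) * h (Y (a + m) \<omega>) \<partial>M) - (\<integral>\<omega>. \<phi> (walk_path Y a \<omega>) \<partial>M) * cube_mean K h\<bar>
    \<le> B * sqrt (cube_mean K (\<lambda>v. ((flip_average K ^^ m) h v - cube_mean K h)\<^sup>2))"
proof -
  interpret prob_space M by (rule hypercube_walk_prob_space[OF walk])
  define d where "d v = (flip_average K ^^ m) h v - cube_mean K h" for v
  have "(\<integral>\<omega>. \<phi> (walk_path Y a \<omega>) * h (Y (a + m) \<omega>) \<partial>M) - (\<integral>\<omega>. \<phi> (walk_path Y a \<omega>) \<partial>M) * cube_mean K h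
    = (\<integral>\<omega>. \<phi> (walk_path Y a \<omega>) * (flip_average K ^^ m) h (Y a \<omega>) \<partial>M) - (\<integral>\<omega>. \<phi> (walk_path Y a \<omega>) * cube_mean K h \<partial>M)"
    by (simp add: walk_many_steps[OF walk K])
  also have "\<dots> = (\<integral>\<omega>. \<phi> (walk_path Y a \<omega>) * d (Y a \<omega>) \<partial>M)"
    unfolding d_def right_diff_distrib
    by (intro Bochner_Integration.integral_diff[symmetric] walk_path_mult_integrable[OF walk]
        integrable_mult_left walk_path_integrable[OF walk])
  also have "\<bar>\<dots>\<bar> \<le> (\<integral>\<omega>. \<bar>\<phi> (walk_path Y a \<omega>) * d (Y a \<omega>)\<bar> \<partial>M)"
    by (rule integral_abs_bound)
  also have "\<dots> \<le> (\<integral>\<omega>. B * \<bar>d (Y a \<omega>)\<bar> \<partial>M)"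
  proof (rule integral_mono)
    show "integrable M (\<lambda>\<omega>. \<bar>\<phi> (walk_path Y a \<omega>) * d (Y a \<omega>)\<bar>)"
      by (rule integrable_abs[OF walk_path_mult_integrable[OF walk]])
    show "integrable M (\<lambda>\<omega>. B * \<bar>d (Y a \<omega>)\<bar>)"
      by (rule walk_integrable[OF walk])
    show "\<bar>\<phi> (walk_path Y a \<omega>) * d (Y a \<omega>)\<bar> \<le> B * \<bar>d (Y a \<omega>)\<bar>" for \<omega>
      unfolding abs_mult by (rule mult_right_mono[OF bound]) simp
  qed
  also have "\<dots> = B * cube_mean K (\<lambda>v. \<bar>d v\<bar>)"
    using walk_stationary[OF walk K, of "\<lambda>v. B * \<bar>d v\<bar>" a] by (simp add: cube_mean_cmult)
  also have "\<dots> \<le> B * sqrt (cube_mean K (\<lambda>v. (d v)\<^sup>2))"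
    \<comment> \<open>The bound at an arbitrary argument supplies B >= 0.\<close>
    using bound[of undefined] by (intro mult_left_mono cube_mean_abs_le_sqrt) auto
  finally show ?thesis by (simp add: d_def)
qed

section \<open>Central limit theorem for the uniform law\<close>

lemma cos_power_tendsto_gaussian:
  fixes \<theta> :: real
  shows "(\<lambda>k. cos (\<theta> / sqrt (real k)) ^ k) \<longlonglongrightarrow> exp (- \<theta>\<^sup>2 / 2)"
proof -
  \<comment> \<open>The expansion is carried out for positive a; evenness of cos covers negative
    \<open>\<theta>\<close>, and \<open>\<theta>\<close> = 0 gives a constant sequence.\<close>
  have pos: "(\<lambda>k. cos (a / sqrt (real k)) ^ k) \<longlonglongrightarrow> exp (- (a * a / 2))" if "a > 0" for a :: real
    using that by real_asymp
  show ?thesis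
  proof (cases "\<theta> = 0")
    case False
    have "cos (\<bar>\<theta>\<bar> / sqrt (real k)) = cos (\<theta> / sqrt (real k))" for k
      by (cases "\<theta> \<ge> 0") (simp_all del: divide_minus_left add: minus_divide_left[symmetric])
    then show ?thesis using pos[of "\<bar>\<theta>\<bar>"] False by (simp add: power2_eq_square)
  qed simp
qed

text \<open>For k = 0 this is the point mass at 0, because division by zero yields 0. Hence every
  member of the sequence is a probability law, as the continuity theorem requires.\<close>

definition cube_sum_law :: "nat \<Rightarrow> real measure" where
  "cube_sum_law k = distr (measure_pmf (pmf_of_set (hypercube k))) borel (\<lambda>v. coord_sum k v / sqrt k)"

lemma real_distribution_cube_sum_law: "real_distribution (cube_sum_law k)"
  unfolding cube_sum_law_def by (intro prob_space.real_distribution_distr) (auto intro: prob_space_measure_pmf)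

text \<open>Vector-valued so as to cover both the complex exponentials of the characteristic
  function and real test functions.\<close>

lemma integral_cube_sum_law:
  fixes f :: "real \<Rightarrow> 'b :: {banach, second_countable_topology}"
  assumes "f \<in> borel_measurable borel"
  shows "(\<integral>x. f x \<partial>cube_sum_law k) = (\<Sum>v\<in>hypercube k. f (coord_sum k v / sqrt k)) /\<^sub>R 2 ^ k"
proof -
  have ne: "hypercube k \<noteq> {}" using card_hypercube[of k] by force
  have "(\<integral>x. f x \<partial>cube_sum_law k) = (\<integral>v. f (coord_sum k v / sqrt k) \<partial>measure_pmf (pmf_of_set (hypercube k)))"
    unfolding cube_sum_law_def using assms by (subst integral_distr) auto
  also have "\<dots> = (\<Sum>v\<in>hypercube k. pmf (pmf_of_set (hypercube k)) v *\<^sub>R f (coord_sum k v / sqrt k))"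
    by (rule integral_measure_pmf[OF finite_hypercube]) (simp add: ne finite_hypercube set_pmf_of_set)
  also have "\<dots> = (\<Sum>v\<in>hypercube k. f (coord_sum k v / sqrt k)) /\<^sub>R 2 ^ k"
    by (simp add: ne finite_hypercube pmf_of_set card_hypercube scaleR_sum_right inverse_eq_divide)
  finally show ?thesis .
qed

text \<open>The exponential of the sum factorises over coordinates; each sign contributes exp(ix) +
  exp(-ix) = 2 cos x, and the normalisation cancels the powers of 2.\<close>

lemma char_cube_sum_law: "char (cube_sum_law k) \<theta> = of_real (cos (\<theta> / sqrt k) ^ k)"
proof -
  have "iexp (\<theta> * (coord_sum k v / sqrt k)) = (\<Prod>i\<in>{1..k}. iexp (\<theta> / sqrt k * v i))" for v
    by (simp add: coord_sum_def exp_sum[symmetric] sum_distrib_left sum_divide_distrib mult_ac)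
  then have "char (cube_sum_law k) \<theta> = (\<Sum>v\<in>hypercube k. \<Prod>i\<in>{1..k}. iexp (\<theta> / sqrt k * v i)) /\<^sub>R 2 ^ k"
    unfolding char_def by (subst integral_cube_sum_law) auto
  also have "(\<Sum>v\<in>hypercube k. \<Prod>i\<in>{1..k}. iexp (\<theta> / sqrt k * v i)) = (2 * cos (of_real (\<theta> / sqrt k))) ^ k"
    by (subst sum_hypercube_prod) (simp add: cos_exp_eq distrib_left[symmetric] add.commute del: distrib_left_numeral)
  finally show ?thesis
    by (simp add: scaleR_conv_of_real power_mult_distrib cos_of_real[symmetric] field_simps)
qed

text \<open>Levy's continuity theorem along all dimensions k. Composing with K afterwards needs only
  that K tends to infinity, not that it is monotone.\<close>

lemma cube_sum_central_limit:
  fixes g :: "real \<Rightarrow> real"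
  assumes g: "continuous_on UNIV g" and bound: "\<And>x. \<bar>g x\<bar> \<le> B"
  shows "(\<lambda>k. cube_mean k (\<lambda>v. g (coord_sum k v / sqrt k))) \<longlonglongrightarrow> (\<integral>x. g x \<partial>std_normal_distribution)"
proof -
  have "weak_conv_m cube_sum_law std_normal_distribution"
    by (rule levy_continuity[OF real_distribution_cube_sum_law real_dist_normal_dist])
       (simp only: char_cube_sum_law char_std_normal_distribution tendsto_of_real_iff cos_power_tendsto_gaussian)
  then have "(\<lambda>k. \<integral>x. g x \<partial>cube_sum_law k) \<longlonglongrightarrow> (\<integral>x. g x \<partial>std_normal_distribution)"
    by (rule weak_conv_imp_integral_bdd_continuous_conv[OF real_distribution_cube_sum_law real_dist_normal_dist, where B = B])
       (use g bound in \<open>auto simp: continuous_on_eq_continuous_at\<close>)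
  then show ?thesis
    using borel_measurable_continuous_onI[OF g]
    by (simp add: integral_cube_sum_law cube_mean_def divide_inverse_commute)
qed

section \<open>Finite-dimensional laws\<close>

lemma white_noise_product_integral:
  fixes g :: "nat \<Rightarrow> real \<Rightarrow> real"
  assumes noise: "gaussian_white_noise N G"
    and fin: "finite I" and t: "\<And>i. i \<in> I \<Longrightarrow> t i \<ge> 0" "inj_on t I"
    and g: "\<And>i. bounded_lipschitz (g i)"
  shows "(\<integral>\<omega>. (\<Prod>i\<in>I. g i (G (t i) \<omega>)) \<partial>N) = (\<Prod>i\<in>I. \<integral>x. g i x \<partial>std_normal_distribution)"
proof -
  interpret prob_space N using noise by (simp add: gaussian_white_noise_def)
  have G: "distributed N lborel (G u) std_normal_density" if "u \<ge> 0" for u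
    using noise that by (simp add: gaussian_white_noise_def)
  have Gm: "G u \<in> borel_measurable N" if "u \<ge> 0" for u
    using distributed_measurable[OF G[OF that]] by simp
  have gm: "g i \<in> borel_measurable borel" for i
    by (rule borel_measurable_continuous_onI[OF bounded_lipschitz_continuous[OF g]])
  \<comment> \<open>Independence is indexed by times, the test functions by positions. Injectivity
    of \<open>t\<close> allows the functions to be relabelled by times.\<close>
  define h where "h u = g (the_inv_into I t u)" for u
  have h: "h (t i) = g i" if "i \<in> I" for i
    using that by (simp add: h_def the_inv_into_f_f[OF t(2)])
  have "indep_vars (\<lambda>_. borel) G (t ` I)"
    using noise t(1) by (auto simp: gaussian_white_noise_def intro: indep_vars_subset)
  then have indep: "indep_vars (\<lambda>_. borel) (\<lambda>u \<omega>. h u (G u \<omega>)) (t ` I)"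
    by (rule indep_vars_compose2) (simp add: h_def gm)
  have int: "integrable N (\<lambda>\<omega>. h u (G u \<omega>))" if "u \<in> t ` I" for u
  proof -
    obtain B where "\<And>x. \<bar>h u x\<bar> \<le> B" using g unfolding h_def bounded_lipschitz_def by metis
    moreover have "(\<lambda>\<omega>. h u (G u \<omega>)) \<in> borel_measurable N"
      using measurable_compose[OF Gm gm] that t(1) by (auto simp: h_def)
    ultimately show ?thesis by (intro integrable_const_bound[where B = B]) auto
  qed
  have "(\<integral>\<omega>. (\<Prod>i\<in>I. g i (G (t i) \<omega>)) \<partial>N) = (\<integral>\<omega>. (\<Prod>u\<in>t ` I. h u (G u \<omega>)) \<partial>N)"
    by (simp add: prod.reindex[OF t(2)] h cong: prod.cong)
  also have "\<dots> = (\<Prod>u\<in>t ` I. \<integral>\<omega>. h u (G u \<omega>) \<partial>N)"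
    using fin by (intro indep_vars_lebesgue_integral indep int) auto
  also have "\<dots> = (\<Prod>i\<in>I. \<integral>\<omega>. g i (G (t i) \<omega>) \<partial>N)"
    by (simp add: prod.reindex[OF t(2)] h cong: prod.cong)
  also have "\<dots> = (\<Prod>i\<in>I. \<integral>x. g i x \<partial>std_normal_distribution)"
  proof (intro prod.cong refl)
    fix i assume "i \<in> I"
    note D = G[OF t(1)[OF this]]
    show "(\<integral>\<omega>. g i (G (t i) \<omega>) \<partial>N) = (\<integral>x. g i x \<partial>std_normal_distribution)"
      unfolding distributed_distr_eq_density[OF D, symmetric]
      by (rule integral_distr[symmetric]) (use distributed_measurable[OF D] gm in auto)
  qed
  finally show ?thesis .
qed

text \<open>Rounding costs less than one step, and one step divided by K n is at most 1; this
  explains the -1 in the lower bound. Strictness of u < v keeps the growth factor positive.\<close>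

lemma floor_gap_at_top:
  fixes u v :: real and K :: "nat \<Rightarrow> nat"
  assumes nK: "filterlim (\<lambda>n. real n / real (K n)) at_top sequentially"
    and K: "\<And>n. n \<ge> 1 \<Longrightarrow> K n \<ge> 1" and uv: "0 \<le> u" "u < v"
  shows "filterlim (\<lambda>n. real (nat \<lfloor>real n * v\<rfloor> - nat \<lfloor>real n * u\<rfloor>) / real (K n)) at_top sequentially"
proof (rule filterlim_at_top_mono)
  show "filterlim (\<lambda>n. - 1 + (v - u) * (real n / real (K n))) at_top sequentially"
    using uv by (intro filterlim_tendsto_add_at_top[OF tendsto_const]
        filterlim_tendsto_pos_mult_at_top[OF tendsto_const] nK) auto
  show "\<forall>\<^sub>F n in sequentially. - 1 + (v - u) * (real n / real (K n))
      \<le> real (nat \<lfloor>real n * v\<rfloor> - nat \<lfloor>real n * u\<rfloor>) / real (K n)"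
    using eventually_ge_at_top[of 1]
  proof eventually_elim
    case (elim n)
    have pos: "0 \<le> real n * u" "0 \<le> real n * v" using uv by auto
    then have "real (nat \<lfloor>real n * u\<rfloor>) \<le> real n * u" "real (nat \<lfloor>real n * v\<rfloor>) > real n * v - 1"
      by (simp_all add: of_nat_nat)
    then have "real n * (v - u) - 1 \<le> real (nat \<lfloor>real n * v\<rfloor> - nat \<lfloor>real n * u\<rfloor>)"
      unfolding right_diff_distrib by linarith
    then have "(real n * (v - u) - 1) / real (K n) \<le> real (nat \<lfloor>real n * v\<rfloor> - nat \<lfloor>real n * u\<rfloor>) / real (K n)"
      by (rule divide_right_mono) simp
    moreover have "1 / real (K n) \<le> 1" using K[OF elim] by simp
    ultimately show ?case by (simp add: diff_divide_distrib mult_ac)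
  qed
qed

text \<open>Apply 1 - x <= exp(-x) with x = 2/K to the power 2m, which gives exp(-4m/K).
  Monotonicity of powers needs a nonnegative base, hence the restriction to K >= 2, which holds
  eventually.\<close>

lemma contraction_power_tendsto_0:
  fixes K m :: "nat \<Rightarrow> nat"
  assumes K: "filterlim K at_top sequentially"
    and mK: "filterlim (\<lambda>n. real (m n) / real (K n)) at_top sequentially"
  shows "(\<lambda>n. (1 - 2 / real (K n)) ^ (2 * m n)) \<longlonglongrightarrow> 0"
proof (rule tendsto_sandwich[OF _ _ tendsto_const])
  show "\<forall>\<^sub>F n in sequentially. 0 \<le> (1 - 2 / real (K n)) ^ (2 * m n)"
    by (simp add: power_mult)
  have "filterlim (\<lambda>n. 4 * (real (m n) / real (K n))) at_top sequentially"
    by (intro filterlim_tendsto_pos_mult_at_top[OF tendsto_const] mK) auto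
  then show "(\<lambda>n. exp (- (4 * (real (m n) / real (K n))))) \<longlonglongrightarrow> 0"
    by (intro filterlim_compose[OF exp_at_bot] filterlim_compose[OF filterlim_uminus_at_bot_at_top])
  have "\<forall>\<^sub>F n in sequentially. K n \<ge> 2" using K by (simp add: filterlim_at_top)
  then show "\<forall>\<^sub>F n in sequentially. (1 - 2 / real (K n)) ^ (2 * m n) \<le> exp (- (4 * (real (m n) / real (K n))))"
  proof eventually_elim
    case (elim n)
    have "(1 - 2 / real (K n)) ^ (2 * m n) \<le> exp (- (2 / real (K n))) ^ (2 * m n)"
      using elim exp_ge_add_one_self[of "- (2 / real (K n))"] by (intro power_mono) auto
    also have "\<dots> = exp (- (4 * (real (m n) / real (K n))))"
      by (simp add: exp_of_nat_mult[symmetric] field_simps)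
    finally show ?case .
  qed
qed

text \<open>Induction on the number of times, splitting off the latest one: the earlier factors form
  a bounded function of the past, and decorrelation turns the integral into a product up to a
  vanishing error. A single time is stationarity plus the central limit theorem.\<close>

lemma walk_product_integral_tendsto:
  fixes K :: "nat \<Rightarrow> nat" and g :: "nat \<Rightarrow> real \<Rightarrow> real"
  assumes walk: "\<And>n. n \<ge> 1 \<Longrightarrow> hypercube_walk (K n) (pmf_of_set (hypercube (K n))) (M (K n)) (Y (K n))"
    and K_pos: "\<And>n. n \<ge> 1 \<Longrightarrow> K n \<ge> 1"
    and K_lim: "filterlim K at_top sequentially"
    and nK_lim: "filterlim (\<lambda>n. real n / real (K n)) at_top sequentially"
    and t_nonneg: "0 \<le> t 1"
    and r: "1 \<le> r"
    and t_less: "\<And>i j. 1 \<le> i \<Longrightarrow> i < j \<Longrightarrow> j \<le> r \<Longrightarrow> t i < t j"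
    and g: "\<And>i. bounded_lipschitz (g i)"
  shows "(\<lambda>n. \<integral>\<omega>. (\<Prod>j\<in>{1..r}. g j (walk_sum Y n (K n) (t j) \<omega> / sqrt (real (K n)))) \<partial>M (K n))
    \<longlonglongrightarrow> (\<Prod>j\<in>{1..r}. \<integral>x. g j x \<partial>std_normal_distribution)"
  using r t_less
proof (induction r rule: nat_induct_at_least)
  case base
  obtain B where B: "\<And>x. \<bar>g 1 x\<bar> \<le> B" using g unfolding bounded_lipschitz_def by metis
  note clt = filterlim_compose[OF cube_sum_central_limit[OF bounded_lipschitz_continuous[OF g] B] K_lim]
  have "\<forall>\<^sub>F n in sequentially. cube_mean (K n) (\<lambda>v. g 1 (coord_sum (K n) v / sqrt (K n))) =
     (\<integral>\<omega>. g 1 (walk_sum Y n (K n) (t 1) \<omega> / sqrt (real (K n))) \<partial>M (K n))"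
    using eventually_ge_at_top[of 1]
  proof eventually_elim
    case (elim n)
    show ?case
      unfolding walk_sum_def by (rule walk_stationary[OF walk[OF elim] K_pos[OF elim], symmetric])
  qed
  from Lim_transform_eventually[OF clt this] show ?case by simp
next
  case (Suc r)
  define X where "X n j \<omega> = walk_sum Y n (K n) (t j) \<omega> / sqrt (real (K n))" for n j \<omega>
  define \<tau> where "\<tau> n j = nat \<lfloor>real n * t j\<rfloor>" for n j
  define W where "W n \<omega> = (\<Prod>j\<in>{1..r}. g j (X n j \<omega>))" for n \<omega>
  define m where "m n = \<tau> n (Suc r) - \<tau> n r" for n
  define h where "h n v = g (Suc r) (coord_sum (K n) v / sqrt (K n))" for n v
  obtain L where L: "\<And>x y. \<bar>g (Suc r) x - g (Suc r) y\<bar> \<le> L * \<bar>x - y\<bar>"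
    using g unfolding bounded_lipschitz_def by metis
  obtain B where B: "\<And>i x. \<bar>g i x\<bar> \<le> B i" using g unfolding bounded_lipschitz_def by metis
  define C where "C = (\<Prod>j\<in>{1..r}. B j)"
  have t_mono: "t i \<le> t r" if "i \<in> {1..r}" for i
    using Suc.prems[of i r] that by (cases "i = r") auto
  have tr: "t r \<ge> 0" using t_nonneg t_mono[of 1] Suc.hyps by simp
  have tr': "t r < t (Suc r)" using Suc.prems[of r "Suc r"] Suc.hyps by simp
  have IH: "(\<lambda>n. \<integral>\<omega>. W n \<omega> \<partial>M (K n)) \<longlonglongrightarrow> (\<Prod>j\<in>{1..r}. \<integral>x. g j x \<partial>std_normal_distribution)"
    unfolding W_def X_def by (rule Suc.IH) (use Suc.prems in auto)
  have clt: "(\<lambda>n. cube_mean (K n) (h n)) \<longlonglongrightarrow> (\<integral>x. g (Suc r) x \<partial>std_normal_distribution)"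
    unfolding h_def
    by (rule filterlim_compose[OF cube_sum_central_limit[OF bounded_lipschitz_continuous[OF g] B] K_lim])
  \<comment> \<open>C bounds the earlier factors, \<open>B (Suc r)\<close> bounds h, and L / sqrt(K
    n) bounds its parity coefficient. C, B and L depend on the test functions only, so the limit in
    n affects just the contraction and 1/K.\<close>
  define err where "err n = C * sqrt ((1 - 2 / real (K n)) ^ (2 * m n) * (B (Suc r))\<^sup>2 + L\<^sup>2 / real (K n))" for n
  have decor: "\<bar>(\<integral>\<omega>. W n \<omega> * h n (Y (K n) (\<tau> n (Suc r)) \<omega>) \<partial>M (K n))
      - (\<integral>\<omega>. W n \<omega> \<partial>M (K n)) * cube_mean (K n) (h n)\<bar> \<le> err n" if n: "n \<ge> 1" for n
  proof -
    \<comment> \<open>The earlier factors as a function of a path, read off at the times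
      \<open>\<tau> n j\<close>. These do not exceed \<open>\<tau> n r\<close>, so the history up to
      that time determines the value.\<close>
    define \<phi> where "\<phi> p = (\<Prod>j\<in>{1..r}. g j (coord_sum (K n) (p (\<tau> n j)) / sqrt (K n)))" for p
    have "\<tau> n j \<le> \<tau> n r" if "j \<in> {1..r}" for j
      unfolding \<tau>_def using t_mono[OF that] by (intro nat_mono floor_mono mult_left_mono) auto
    then have W: "W n \<omega> = \<phi> (walk_path (Y (K n)) (\<tau> n r) \<omega>)" for \<omega>
      unfolding W_def \<phi>_def X_def walk_sum_def \<tau>_def[symmetric] by (intro prod.cong) auto
    \<comment> \<open>With this monotonicity the truncated subtraction in \<open>m n\<close> is a
      genuine difference.\<close>
    have "\<tau> n r \<le> \<tau> n (Suc r)"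
      unfolding \<tau>_def using tr' by (intro nat_mono floor_mono mult_left_mono) auto
    then have \<tau>: "\<tau> n (Suc r) = \<tau> n r + m n" by (simp add: m_def)
    have \<phi>: "\<bar>\<phi> p\<bar> \<le> C" for p
      unfolding \<phi>_def C_def abs_prod using B by (intro prod_mono) auto
    have C0: "C \<ge> 0" using \<phi>[of undefined] by linarith
    have "cube_mean (K n) (\<lambda>v. ((flip_average (K n) ^^ m n) (h n) v - cube_mean (K n) (h n))\<^sup>2)
      \<le> (1 - 2 / real (K n)) ^ (2 * m n) * cube_mean (K n) (\<lambda>v. (h n v)\<^sup>2)
        + (cube_mean (K n) (\<lambda>v. h n v * walsh {1..K n} v))\<^sup>2"
      by (rule flip_average_variance_decay[OF K_pos[OF n]])
    also have "\<dots> \<le> (1 - 2 / real (K n)) ^ (2 * m n) * (B (Suc r))\<^sup>2 + L\<^sup>2 / real (K n)"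
    proof (intro add_mono mult_left_mono)
      have "cube_mean (K n) (\<lambda>v. (h n v)\<^sup>2) \<le> cube_mean (K n) (\<lambda>_. (B (Suc r))\<^sup>2)"
        using B[of "Suc r"] order_trans[OF abs_ge_zero B[of "Suc r"]]
        by (intro cube_mean_mono) (auto simp: h_def abs_le_square_iff[symmetric])
      then show "cube_mean (K n) (\<lambda>v. (h n v)\<^sup>2) \<le> (B (Suc r))\<^sup>2" by (simp add: cube_mean_const)
      have "\<bar>cube_mean (K n) (\<lambda>v. h n v * walsh {1..K n} v)\<bar> \<le> L / sqrt (K n)"
        unfolding h_def by (rule parity_coefficient_le[OF K_pos[OF n] L])
      from power_mono[OF this abs_ge_zero, of 2]
      show "(cube_mean (K n) (\<lambda>v. h n v * walsh {1..K n} v))\<^sup>2 \<le> L\<^sup>2 / real (K n)"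
        by (simp add: power_divide)
    qed (simp add: power_mult)
    finally have "C * sqrt (cube_mean (K n) (\<lambda>v. ((flip_average (K n) ^^ m n) (h n) v - cube_mean (K n) (h n))\<^sup>2)) \<le> err n"
      unfolding err_def by (intro mult_left_mono C0 real_sqrt_le_mono)
    with walk_decorrelation[OF walk[OF n] K_pos[OF n], where \<phi> = \<phi> and a = "\<tau> n r" and h = "h n" and m = "m n", OF \<phi>]
    show ?thesis unfolding W \<tau> by linarith
  qed
  have "(\<lambda>n. err n) \<longlonglongrightarrow> C * sqrt (0 * (B (Suc r))\<^sup>2 + 0)"
    unfolding err_def
  proof (intro tendsto_intros)
    show "(\<lambda>n. (1 - 2 / real (K n)) ^ (2 * m n)) \<longlonglongrightarrow> 0"
      unfolding m_def \<tau>_def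
      by (intro contraction_power_tendsto_0 K_lim floor_gap_at_top nK_lim K_pos tr tr')
    show "(\<lambda>n. L\<^sup>2 / real (K n)) \<longlonglongrightarrow> 0"
      by (intro tendsto_divide_0[OF tendsto_const] filterlim_at_top_imp_at_infinity
          filterlim_compose[OF filterlim_real_sequentially K_lim])
  qed
  then have err: "err \<longlonglongrightarrow> 0" by simp
  have "(\<lambda>n. (\<integral>\<omega>. W n \<omega> * h n (Y (K n) (\<tau> n (Suc r)) \<omega>) \<partial>M (K n))
      - (\<integral>\<omega>. W n \<omega> \<partial>M (K n)) * cube_mean (K n) (h n)) \<longlonglongrightarrow> 0"
    using decor by (intro Lim_null_comparison[OF _ err] eventually_sequentiallyI[of 1]) simp
  from tendsto_add[OF this tendsto_mult[OF IH clt]]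
  have "(\<lambda>n. \<integral>\<omega>. W n \<omega> * h n (Y (K n) (\<tau> n (Suc r)) \<omega>) \<partial>M (K n))
    \<longlonglongrightarrow> (\<Prod>j\<in>{1..r}. \<integral>x. g j x \<partial>std_normal_distribution) * (\<integral>x. g (Suc r) x \<partial>std_normal_distribution)"
    by simp
  then show ?case
    unfolding W_def h_def X_def walk_sum_def \<tau>_def using Suc.hyps by (simp add: prod.nat_ivl_Suc' mult_ac)
qed

lemma integral_vec_law_prod:
  fixes g :: "nat \<Rightarrow> real \<Rightarrow> real"
  assumes X: "(\<lambda>\<omega>. \<lambda>i\<in>{1..s}. X i \<omega>) \<in> measurable Q (PiM {1..s} (\<lambda>_. borel))"
    and g: "\<And>i. bounded_lipschitz (g i)"
  shows "(\<integral>x. (\<Prod>i\<in>{1..s}. g i (x i)) \<partial>vec_law s Q X) = (\<integral>\<omega>. (\<Prod>i\<in>{1..s}. g i (X i \<omega>)) \<partial>Q)"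
proof -
  have "(\<lambda>x. \<Prod>i\<in>{1..s}. g i (x i)) \<in> borel_measurable (PiM {1..s} (\<lambda>_. borel))"
    using product_sum_measurable[OF product_sum.prod[of g "{1..s}" 1] refl] g by simp
  then show ?thesis
    unfolding vec_law_def by (subst integral_distr[OF X]) (auto intro!: Bochner_Integration.integral_cong prod.cong)
qed

theorem corollary2:
  fixes K :: "nat \<Rightarrow> nat"
    and M :: "nat \<Rightarrow> 'a measure"
    and Y :: "nat \<Rightarrow> nat \<Rightarrow> 'a \<Rightarrow> nat \<Rightarrow> real"
    and \<mu> :: "nat \<Rightarrow> (nat \<Rightarrow> real) pmf"
    and N :: "'b measure"
    and G :: "real \<Rightarrow> 'b \<Rightarrow> real"
    and s :: nat
    and t :: "nat \<Rightarrow> real"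
  assumes walk: "\<And>k. k \<ge> 1 \<Longrightarrow> hypercube_walk k (\<mu> k) (M k) (Y k)"
    and K_pos: "\<And>n. n \<ge> 1 \<Longrightarrow> K n \<ge> 1"
    and K_lim: "filterlim K at_top sequentially"
    and nK_lim: "filterlim (\<lambda>n. real n / real (K n)) at_top sequentially"
    and uniform: "\<And>n. n \<ge> 1 \<Longrightarrow> \<mu> (K n) = pmf_of_set (hypercube (K n))"
    and noise: "gaussian_white_noise N G"
    and s_pos: "s \<ge> 1"
    and t_nonneg: "0 \<le> t 1"
    and t_less: "\<And>i j. 1 \<le> i \<Longrightarrow> i < j \<Longrightarrow> j \<le> s \<Longrightarrow> t i < t j"
  shows "weak_conv_in (product_topology (\<lambda>_. euclideanreal) {1..s})
           (\<lambda>n. vec_law s (M (K n)) (\<lambda>i \<omega>. walk_sum Y n (K n) (t i) \<omega> / sqrt (real (K n))))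
           (vec_law s N (\<lambda>i. G (t i)))"
proof -
  define Z where "Z n i \<omega> = walk_sum Y n (K n) (t i) \<omega> / sqrt (real (K n))" for n i \<omega>
  let ?P = "PiM {1..s} (\<lambda>_. borel) :: (nat \<Rightarrow> real) measure"
  have walk': "hypercube_walk (K n) (pmf_of_set (hypercube (K n))) (M (K n)) (Y (K n))" if "n \<ge> 1" for n
    using walk[OF K_pos[OF that]] uniform[OF that] by simp
  have t0: "t i \<ge> 0" if "i \<in> {1..s}" for i
    using t_nonneg t_less[of 1 i] that by (cases "i = 1") auto
  have t_inj: "inj_on t {1..s}"
    by (rule linorder_inj_onI) (use t_less in \<open>auto simp: less_le\<close>)
  interpret N: prob_space N using noise by (simp add: gaussian_white_noise_def)
  have Zm: "(\<lambda>\<omega>. \<lambda>i\<in>{1..s}. Z n i \<omega>) \<in> measurable (M (K n)) ?P" if "n \<ge> 1" for n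
    using walk_integrable[OF walk'[OF that], of "\<lambda>v. coord_sum (K n) v / sqrt (real (K n))"]
    by (intro measurable_restrict) (auto simp: Z_def walk_sum_def dest: borel_measurable_integrable)
  have Gm: "(\<lambda>\<omega>. \<lambda>i\<in>{1..s}. G (t i) \<omega>) \<in> measurable N ?P"
    using noise t0 distributed_measurable[of N lborel]
    by (intro measurable_restrict) (fastforce simp: gaussian_white_noise_def)
  \<comment> \<open>The hypotheses speak of n >= 1 only, and at n = 0 there need not be a
    probability law. The criterion, which wants one for every index, is applied to the shifted
    sequence; the shift does not affect the limit.\<close>
  have "weak_conv_in (product_topology (\<lambda>_. euclideanreal) {1..s})
     (\<lambda>n. vec_law s (M (K (Suc n))) (Z (Suc n))) (vec_law s N (\<lambda>i. G (t i)))"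
  proof (rule weak_conv_in_product_topologyI)
    fix n
    interpret prob_space "M (K (Suc n))" by (rule hypercube_walk_prob_space[OF walk']) simp
    show "prob_space (vec_law s (M (K (Suc n))) (Z (Suc n)))"
      unfolding vec_law_def by (rule prob_space_distr[OF Zm]) simp
  next
    show "prob_space (vec_law s N (\<lambda>i. G (t i)))"
      unfolding vec_law_def by (rule N.prob_space_distr[OF Gm])
  next
    fix g :: "nat \<Rightarrow> real \<Rightarrow> real" assume g: "\<And>i. bounded_lipschitz (g i)"
    have "(\<lambda>n. \<integral>\<omega>. (\<Prod>i\<in>{1..s}. g i (Z n i \<omega>)) \<partial>M (K n)) \<longlonglongrightarrow> (\<Prod>i\<in>{1..s}. \<integral>x. g i x \<partial>std_normal_distribution)"
      unfolding Z_def
      by (rule walk_product_integral_tendsto[where K = K and M = M and Y = Y and t = t, OF walk' K_pos K_lim nK_lim t_nonneg s_pos t_less g])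
    also have "(\<Prod>i\<in>{1..s}. \<integral>x. g i x \<partial>std_normal_distribution) = (\<integral>\<omega>. (\<Prod>i\<in>{1..s}. g i (G (t i) \<omega>)) \<partial>N)"
      by (rule white_noise_product_integral[OF noise _ t0 t_inj g, symmetric]) simp
    finally have "(\<lambda>n. \<integral>\<omega>. (\<Prod>i\<in>{1..s}. g i (Z (Suc n) i \<omega>)) \<partial>M (K (Suc n)))
        \<longlonglongrightarrow> (\<integral>\<omega>. (\<Prod>i\<in>{1..s}. g i (G (t i) \<omega>)) \<partial>N)"
      by (rule LIMSEQ_Suc)
    also have "(\<lambda>n. \<integral>\<omega>. (\<Prod>i\<in>{1..s}. g i (Z (Suc n) i \<omega>)) \<partial>M (K (Suc n))) =
        (\<lambda>n. \<integral>x. (\<Prod>i\<in>{1..s}. g i (x i)) \<partial>vec_law s (M (K (Suc n))) (Z (Suc n)))"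
      by (subst integral_vec_law_prod[OF Zm g]) simp_all
    also have "(\<integral>\<omega>. (\<Prod>i\<in>{1..s}. g i (G (t i) \<omega>)) \<partial>N) =
        (\<integral>x. (\<Prod>i\<in>{1..s}. g i (x i)) \<partial>vec_law s N (\<lambda>i. G (t i)))"
      by (rule integral_vec_law_prod[OF Gm g, symmetric])
    finally show "(\<lambda>n. \<integral>x. (\<Prod>i\<in>{1..s}. g i (x i)) \<partial>vec_law s (M (K (Suc n))) (Z (Suc n)))
        \<longlonglongrightarrow> (\<integral>x. (\<Prod>i\<in>{1..s}. g i (x i)) \<partial>vec_law s N (\<lambda>i. G (t i)))" .
  qed (simp_all add: vec_law_def)
  then show ?thesis
    unfolding weak_conv_in_def Z_def by (blast intro: LIMSEQ_imp_Suc)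
qed

end
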